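(* Let $((X_t,\sigma_t))_{t\in\mathbb Z}$ be a stationary EGARCH process, i.e. $X_t=\sigma_tZ_t$ and $\log\sigma_t^2=\alpha_0+\beta_0\log\sigma_{t-1}^2+\gamma_0Z_{t-1}+\delta_0|Z_{t-1}|$ for $t\in\mathbb Z$, with true parameter $\theta_0=(\alpha_0,\beta_0,\gamma_0,\delta_0)^T$ satisfying $0\le\beta_0<1$, $\delta_0\ge|\gamma_0|$ and $(\gamma_0,\delta_0)\ne(0,0)$, where $(Z_t)$ is i.i.d. with $\mathbb EZ_0=0$, $\mathbb EZ_0^2=1$, and the distribution of $Z_0$ is not concentrated at two points. Let $K\subset\mathbb R\times[0,1)\times D_E$ be a compact set with $\theta_0\in K$ such that $\mathbb E(\log\|\lambda_0\|_K)<0$, where $\lambda_0(\theta)=\max\big(\beta,\ 2^{-1}\exp(-m/2)(\gamma X_0+\delta|X_0|)-\beta\big)$ for $\theta=(\alpha,\beta,\gamma,\delta)^T\in K$, and $m=\inf_{\theta\in K}\alpha(1-\beta)^{-1}$. Then the QMLE $\hat\theta_n$ is strongly consistent, i.e. $\hat\theta_n\to\theta_0$ a.s.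
   Context: $D_E=\{(\gamma,\delta)^T\in\mathbb R^2:\delta\ge|\gamma|\}$; parameters are $\theta=(\alpha,\beta,\gamma,\delta)^T$. The stationary solution is $\log\sigma_t^2=\alpha_0(1-\beta_0)^{-1}+\sum_{k\ge0}\beta_0^k(\gamma_0Z_{t-1-k}+\delta_0|Z_{t-1-k}|)$. $\|v\|_K=\sup_{\theta\in K}|v(\theta)|$. For a fixed $\varsigma_0^2>0$, define the random functions on $K$: $\log\hat h_0(\theta)=\log\varsigma_0^2$ and $\log\hat h_{t+1}(\theta)=\alpha+\beta\log\hat h_t(\theta)+(\gamma X_t+\delta|X_t|)\exp(-\log\hat h_t(\theta)/2)$, $t\ge0$. Given data $X_0,\dots,X_n$, $\hat L_n(\theta)=-\frac12\sum_{t=1}^n(X_t^2/\hat h_t(\theta)+\log\hat h_t(\theta))$ and the QMLE $\hat\theta_n$ is a maximizer of $\hat L_n$ over $K$. *)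

theory Defs
  imports "HOL-Probability.Probability"
begin

type_synonym egarch_param = "real \<times> real \<times> real \<times> real"

definition par_alpha :: "egarch_param \<Rightarrow> real" where "par_alpha th = fst th"
definition par_beta  :: "egarch_param \<Rightarrow> real" where "par_beta th = fst (snd th)"
definition par_gamma :: "egarch_param \<Rightarrow> real" where "par_gamma th = fst (snd (snd th))"
definition par_delta :: "egarch_param \<Rightarrow> real" where "par_delta th = snd (snd (snd th))"

definition egarch_space :: "egarch_param set" where
  "egarch_space = {th. 0 \<le> par_beta th \<and> par_beta th < 1 \<and> par_delta th \<ge> \<bar>par_gamma th\<bar>}"

fun egarch_logh :: "real \<Rightarrow> egarch_param \<Rightarrow> (nat \<Rightarrow> real) \<Rightarrow> nat \<Rightarrow> real" where
  "egarch_logh s th x 0 = ln (s\<^sup>2)"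
| "egarch_logh s th x (Suc t) =
     par_alpha th + par_beta th * egarch_logh s th x t
     + (par_gamma th * x t + par_delta th * \<bar>x t\<bar>) * exp (- egarch_logh s th x t / 2)"

definition egarch_lik :: "real \<Rightarrow> egarch_param \<Rightarrow> (nat \<Rightarrow> real) \<Rightarrow> nat \<Rightarrow> real" where
  "egarch_lik s th x n =
     - (1/2) * (\<Sum>t=1..n. (x t)\<^sup>2 / exp (egarch_logh s th x t) + egarch_logh s th x t)"

definition egarch_m :: "egarch_param set \<Rightarrow> real" where
  "egarch_m K = (INF th\<in>K. par_alpha th / (1 - par_beta th))"

definition egarch_lambda0 :: "egarch_param set \<Rightarrow> egarch_param \<Rightarrow> real \<Rightarrow> real" where
  "egarch_lambda0 K th x0 =
     max (par_beta th)
         (1/2 * exp (- egarch_m K / 2) * (par_gamma th * x0 + par_delta th * \<bar>x0\<bar>) - par_beta th)"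

definition supK :: "egarch_param set \<Rightarrow> (egarch_param \<Rightarrow> real) \<Rightarrow> real" where
  "supK K v = (SUP th\<in>K. \<bar>v th\<bar>)"

text \<open>E(log f) < 0 for a nonnegative random variable f, with the expectation taken in the
  extended sense (E log^+ f < E log^- f, where log 0 = -infinity).\<close>
definition log_mean_neg :: "'a measure \<Rightarrow> ('a \<Rightarrow> real) \<Rightarrow> bool" where
  "log_mean_neg M f \<longleftrightarrow>
     (\<integral>\<^sup>+ w. ennreal (max 0 (ln (f w))) \<partial>M)
     < (\<integral>\<^sup>+ w. (if f w \<le> 0 then \<infinity> else ennreal (max 0 (- ln (f w)))) \<partial>M)"

end

theory Submission
  imports Defs
begin

text \<open>
  Everything is transferred to the path space of the innovations, on which the shift is ergodic.
  The contraction condition makes the volatility recursion forget its initial value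
  exponentially fast, uniformly on the parameter set, so it has a stationary solution that is
  continuous in the parameter and may replace the recursion started at an arbitrary value.
  Integrating out the innovation at time 0 and using \<open>exp u \<ge> 1 + u\<close> shows that the expected loss
  is minimized exactly at the true parameter: equality would force an affine relation between
  the innovation and its absolute value, which a law not concentrated on two points excludes.
  Wald's argument (an ergodic lower bound for the infimum of the loss over small balls, and
  compactness) then gives consistency.
  The only ergodic theorem needed is that partial sums of a stationary sequence with negative
  mean are bounded above; it yields the exponential decay, the subexponential growth and the
  loss gap alike.
\<close>

section \<open>Sums along an ergodic transformation\<close>

text \<open>The contraction factor is a slope bound: the derivative in \<open>v\<close> of
  \<open>egarch_step th x v\<close> is \<open>par_beta th - news th x * exp (- v / 2) / 2\<close>,
  and for \<open>v \<ge> egarch_m K\<close> its absolute value is at most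
  \<open>egarch_lambda0 K th x\<close>. This holds on that half-line only, so every contraction
  argument is accompanied by a lower bound on the iterates, which rests on
  \<open>news th x \<ge> 0\<close>, that is, on the cone condition for the last two parameters. Two
  integrability obstacles shape the rest. The logarithm of the contraction factor may have mean
  minus infinity, so it is truncated from below before it is summed. The expected loss at a wrong
  parameter may be infinite, so the lower bound \<open>egarch_m K\<close> is subtracted,
  expectations are compared as integrals of nonnegative functions, and infima are truncated from
  above. Every almost sure bound carries a constant that depends on the path but not on the
  parameter or the time. This is why the exceptional null set can be chosen before the estimator:
  consistency is proved on the path space for all admissible sequences of estimates at once.\<close>

text \<open>Neveu's argument: on the invariant set where the partial sums are unbounded, the running
  maximum \<^term>\<open>m n\<close> of the sums satisfies \<open>m (n+1) - m n \<circ> T \<longlongrightarrow> f\<close>, while the integrals of these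
  differences are nonnegative by invariance.\<close>

lemma (in prob_space) ergodic_sums_bounded:
  fixes f :: "'a \<Rightarrow> real" and T :: "'a \<Rightarrow> 'a"
  assumes T: "T \<in> measurable M M" and inv: "distr M M T = M"
    and erg: "\<And>A. A \<in> sets M \<Longrightarrow> T -` A \<inter> space M = A \<Longrightarrow> prob A = 0 \<or> prob A = 1"
    and f: "integrable M f" and neg: "expectation f < 0"
  shows "AE w in M. \<exists>C. \<forall>n. (\<Sum>t<n. f ((T ^^ t) w)) \<le> C"
proof -
  note [measurable] = T
  have fm [measurable]: "f \<in> borel_measurable M" using f by simp
  have Tn [measurable]: "(T ^^ t) \<in> measurable M M" for t
    by (induction t) simp_all
  define S where "S n w = (\<Sum>t<n. f ((T ^^ t) w))" for n :: nat and w
  have S_Suc: "S (Suc n) w = f w + S n (T w)" for n w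
    unfolding S_def sum.lessThan_Suc_shift by (simp add: funpow_swap1)
  have [measurable]: "S n \<in> borel_measurable M" for n
    unfolding S_def by measurable
  define A where "A = {w \<in> space M. \<forall>C::nat. \<exists>n. S n w > real C}"
  have A [measurable]: "A \<in> sets M" unfolding A_def by measurable
  have unbdd: "(\<forall>C::nat. \<exists>n. S n w > real C) \<longleftrightarrow> (\<forall>C. \<exists>n. S n w > C)" for w
    by (meson le_less_trans reals_Archimedean2 less_imp_le)
  have A_inv: "T w \<in> A \<longleftrightarrow> w \<in> A" if w: "w \<in> space M" for w
  proof -
    have Tw: "T w \<in> space M" using w T by (auto simp: measurable_def)
    \<comment> \<open>\<open>C \<ge> 0\<close> rules out the empty sum \<open>S 0 w = 0\<close>, so
      a large sum at \<open>w\<close> can split off its first term.\<close>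
    have "(\<exists>n. S n w > C) \<longleftrightarrow> (\<exists>n. S n (T w) > C - f w)" if "C \<ge> 0" for C
    proof
      assume "\<exists>n. S n w > C"
      then obtain n where n: "S n w > C" by auto
      then have "n \<noteq> 0" using that by (auto simp: S_def intro: ccontr)
      then obtain k where "n = Suc k" using not0_implies_Suc by blast
      with n show "\<exists>n. S n (T w) > C - f w" by (auto simp: S_Suc intro!: exI[of _ k])
    next
      assume "\<exists>n. S n (T w) > C - f w"
      then obtain n where "S n (T w) > C - f w" by auto
      then have "S (Suc n) w > C" by (simp add: S_Suc)
      then show "\<exists>n. S n w > C" by blast
    qed
    then have e: "(\<exists>n. S n w > C) \<longleftrightarrow> (\<exists>n. S n (T w) > C - f w)" if "C \<ge> 0" for C using that by blast
    show ?thesis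
    proof
      assume "T w \<in> A"
      then have "\<forall>C. \<exists>n. S n (T w) > C" using unbdd unfolding A_def by auto
      then have "\<forall>C::nat. \<exists>n. S n w > real C" using e by simp
      then show "w \<in> A" using w by (simp add: A_def)
    next
      assume "w \<in> A"
      then have "\<forall>C. \<exists>n. S n w > C" using unbdd unfolding A_def by auto
      then have a: "\<exists>n. S n (T w) > C - f w" if "C \<ge> 0" for C using e that by blast
      have "\<exists>n. S n (T w) > real C" for C
      proof -
        obtain n where "S n (T w) > (C + \<bar>f w\<bar>) - f w" using a[of "C + \<bar>f w\<bar>"] by auto
        then show ?thesis by (intro exI[of _ n]) linarith
      qed
      then show "T w \<in> A" using Tw by (simp add: A_def)
    qed
  qed
  \<comment> \<open>\<open>m n w\<close> is the maximum of \<open>S 1 w, ..., S (n + 1) w\<close>.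
    Leaving out the empty sum gives \<open>m n \<ge> f\<close>, the source of the domination below;
    the recursive form gives integrability by induction.\<close>
  define m where "m = rec_nat f (\<lambda>_ g w. f w + max 0 (g (T w)))"
  have m0: "m 0 = f" and mS: "m (Suc n) w = f w + max 0 (m n (T w))" for n w
    by (simp_all add: m_def)
  have mge: "f w \<le> m n w" for n w by (cases n) (simp_all add: m0 mS)
  have mmono: "m n w \<le> m (Suc n) w" for n w
    by (induction n arbitrary: w) (auto simp: m0 mS max_def split: if_splits, (smt (verit))+)
  have minc: "m n w \<le> m k w" if "n \<le> k" for n k w
    using that mmono by (rule lift_Suc_mono_le[of "\<lambda>n. m n w", rotated])
  have mS_ge: "S (Suc k) w \<le> m n w" if "k \<le> n" for k n w
    using that
  proof (induction k arbitrary: n w)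
    case 0 then show ?case using mge by (simp add: S_def)
  next
    case (Suc k)
    then obtain n' where n': "n = Suc n'" "k \<le> n'" by (cases n) auto
    have "S (Suc (Suc k)) w = f w + S (Suc k) (T w)" by (rule S_Suc)
    also have "\<dots> \<le> f w + max 0 (m n' (T w))" using Suc.IH[OF n'(2), of "T w"] by simp
    finally show ?case by (simp add: n' mS)
  qed
  have fT: "integrable M (\<lambda>w. g (T w))" if "integrable M g" for g :: "'a \<Rightarrow> real"
  proof (rule integrable_distr[OF T])
    show "integrable (distr M M T) g" using that inv by simp
  qed
  have mint [simp]: "integrable M (m n)" for n
  proof (induction n)
    case (Suc n)
    have "integrable M (\<lambda>w. f w + max 0 (m n (T w)))"
      using f fT[OF Suc] by (intro Bochner_Integration.integrable_add integrable_max) auto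
    then show ?case using mS by presburger
  qed (simp add: m0 f)
  have ET: "expectation (\<lambda>w. g (T w)) = expectation g" if "g \<in> borel_measurable M" for g :: "'a \<Rightarrow> real"
    using integral_distr[OF T that] inv by simp
  \<comment> \<open>By \<open>max 0 x - x = max 0 (- x)\<close> this is
    \<open>m (Suc n) w - m n (T w)\<close> on \<open>A\<close>, in a form where limit and domination
    can be read off.\<close>
  define F where "F n w = indicator A w * (f w + max 0 (- m n (T w)))" for n w
  have F_nonneg: "0 \<le> expectation (F n)" for n
  proof -
    have i1: "integrable M (\<lambda>w. indicator A w * m k w)" for k
      using integrable_mult_indicator[OF A mint, of k] by simp
    have "F n w = indicator A w * m (Suc n) w - indicator A (T w) * m n (T w)" if "w \<in> space M" for w
      using A_inv[OF that] by (auto simp: F_def mS indicator_def max_def)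
    then have "expectation (F n) = expectation (\<lambda>w. indicator A w * m (Suc n) w - indicator A (T w) * m n (T w))"
      by (intro Bochner_Integration.integral_cong) auto
    also have "\<dots> = expectation (\<lambda>w. indicator A w * m (Suc n) w) - expectation (\<lambda>w. indicator A (T w) * m n (T w))"
      using i1 fT[OF i1] by (intro Bochner_Integration.integral_diff) auto
    also have "expectation (\<lambda>w. indicator A (T w) * m n (T w)) = expectation (\<lambda>w. indicator A w * m n w)"
      using borel_measurable_integrable[OF i1] by (rule ET)
    also have "expectation (\<lambda>w. indicator A w * m (Suc n) w) - \<dots> \<ge> 0"
      using mmono by (simp add: i1 integral_mono mult_left_mono)
    finally show ?thesis .
  qed
  have lim: "(\<lambda>n. F n w) \<longlonglongrightarrow> indicator A w * f w" if w: "w \<in> space M" for w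
  proof (cases "w \<in> A")
    case True
    then have "T w \<in> A" using A_inv w by simp
    \<comment> \<open>One positive sum from \<open>T w\<close> makes all later running maxima
      positive, and the correction term in \<open>F\<close> vanishes from then on.\<close>
    then obtain k where k: "S k (T w) > 0" by (auto simp: A_def dest!: spec[where x=0])
    then have "k \<noteq> 0" by (auto simp: S_def intro: ccontr)
    then obtain j where "k = Suc j" using not0_implies_Suc by blast
    then have "m n (T w) > 0" if "n \<ge> j" for n using mS_ge[OF that, of "T w"] k by simp
    then have "F n w = indicator A w * f w" if "n \<ge> j" for n using that
      unfolding F_def by (metis add.right_neutral less_imp_le max_absorb1 neg_le_0_iff_le)
    then show ?thesis by (intro tendsto_eventually eventually_sequentiallyI) blast
  qed (simp add: F_def)
  have "(\<lambda>n. expectation (F n)) \<longlonglongrightarrow> expectation (\<lambda>w. indicator A w * f w)"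
  proof (rule integral_dominated_convergence[where w="\<lambda>w. \<bar>f w\<bar> + \<bar>f (T w)\<bar>"])
    show "integrable M (\<lambda>w. \<bar>f w\<bar> + \<bar>f (T w)\<bar>)" using f fT[OF f] by auto
    show "F n \<in> borel_measurable M" for n
      using borel_measurable_integrable[OF mint[of n]] unfolding F_def by measurable
    show "AE w in M. norm (F n w) \<le> \<bar>f w\<bar> + \<bar>f (T w)\<bar>" for n
    proof (rule AE_I2)
      fix w show "norm (F n w) \<le> \<bar>f w\<bar> + \<bar>f (T w)\<bar>"
        using mge[of "T w" n] by (auto simp: F_def indicator_def)
    qed
  qed (use lim in auto)
  then have nonneg: "0 \<le> expectation (\<lambda>w. indicator A w * f w)"
    using F_nonneg by (intro LIMSEQ_le_const) auto
  have "prob A \<noteq> 1"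
  proof
    assume "prob A = 1"
    then have "AE w in M. w \<in> A" by (subst (asm) prob_eq_1) auto
    then have "expectation (\<lambda>w. indicator A w * f w) = expectation f"
      by (intro integral_cong_AE) auto
    with nonneg neg show False by simp
  qed
  moreover have "T -` A \<inter> space M = A" using A_inv by (auto simp: A_def)
  ultimately have "prob A = 0" using erg[OF A] by blast
  then have "AE w in M. w \<notin> A" using A by (simp add: AE_iff_measurable[OF A] emeasure_eq_measure prob_eq_0)
  then show ?thesis
  proof (rule AE_mp, intro AE_I2 impI)
    fix w assume "w \<in> space M" "w \<notin> A"
    then obtain C :: nat where "\<forall>n. S n w \<le> real C" by (auto simp: A_def not_less)
    then show "\<exists>C. \<forall>n. (\<Sum>t<n. f ((T ^^ t) w)) \<le> C" unfolding S_def by blast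
  qed
qed

section \<open>The shift on the path space of an i.i.d. sequence\<close>

text \<open>The step is an arbitrary integer because both directions are used: \<open>s = 1\<close>
  for sums over the sample, \<open>s = -1\<close> for the past that drives the backward
  iteration.\<close>

definition tshift :: "int \<Rightarrow> (int \<Rightarrow> 'b) \<Rightarrow> int \<Rightarrow> 'b" where
  "tshift s w = (\<lambda>i. w (i + s))"

lemma shift_0 [simp]: "tshift 0 w = w"
  by (simp add: tshift_def)

lemma shift_shift [simp]: "tshift s (tshift t w) = tshift (s + t) w"
  by (simp add: tshift_def fun_eq_iff algebra_simps)

lemma funpow_tshift: "(tshift s ^^ n) w = tshift (s * int n) w"
  by (induction n) (simp_all add: algebra_simps)

locale iid_path =
  fixes D :: "'b measure"
  assumes prob_D: "prob_space D"
begin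

sublocale D: prob_space D by (rule prob_D)

definition W :: "(int \<Rightarrow> 'b) measure" where
  "W = PiM UNIV (\<lambda>_. D)"

sublocale P: product_prob_space "\<lambda>_::int. D" UNIV
  by unfold_locales

sublocale W: prob_space W
  unfolding W_def by (rule P.prob_space_axioms)

lemma space_W: "space W = {w. \<forall>i. w i \<in> space D}"
  by (auto simp: W_def space_PiM PiE_def)

lemma measurable_coord [measurable]: "(\<lambda>w. w i) \<in> measurable W D"
  unfolding W_def by simp

lemma measurable_W_I: "(\<And>i. (\<lambda>w. f w i) \<in> measurable N D) \<Longrightarrow> f \<in> measurable N W"
  unfolding W_def by (rule measurable_PiM_single'[where f="\<lambda>i w. f w i"]) (auto simp: PiE_def measurable_def)

lemma measurable_shift [measurable]: "tshift s \<in> measurable W W"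
  by (rule measurable_W_I) (simp add: tshift_def)

lemma distr_shift: "distr W W (tshift s) = W"
proof -
  have "inj_on (\<lambda>i::int. i + s) UNIV" by (auto simp: inj_on_def)
  then show ?thesis
    using distr_PiM_reindex[of UNIV "\<lambda>_. D" "\<lambda>i::int. i + s" UNIV] prob_D
    by (simp add: W_def tshift_def[abs_def] restrict_def)
qed

lemma AE_shift:
  assumes "AE w in W. P w" shows "AE w in W. P (tshift s w)"
  using AE_distrD[of "tshift s" W W P] assms unfolding distr_shift by simp

lemma AE_all_shift:
  assumes "AE w in W. P w" shows "AE w in W. \<forall>t. P (tshift t w)"
  using AE_shift[OF assms] by (simp add: AE_all_countable)

lemma prob_shift_vimage:
  assumes "A \<in> sets W" shows "measure W (tshift s -` A \<inter> space W) = measure W A"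
  using measure_distr[OF measurable_shift assms, of s] by (simp add: distr_shift)

lemma shift_in_space: "w \<in> space W \<Longrightarrow> tshift s w \<in> space W"
  by (simp add: space_W tshift_def)

section \<open>Cylinder sets, mixing and ergodicity of the shift\<close>

definition cylinder :: "int set \<Rightarrow> (int \<Rightarrow> 'b set) \<Rightarrow> (int \<Rightarrow> 'b) set" where
  "cylinder J E = {w \<in> space W. \<forall>i\<in>J. w i \<in> E i}"

lemma prob_cylinder:
  assumes "finite J" "\<And>i. i \<in> J \<Longrightarrow> E i \<in> sets D"
  shows "measure W (cylinder J E) = (\<Prod>i\<in>J. measure D (E i))"
proof -
  have "emeasure W (cylinder J E) = (\<Prod>i\<in>J. emeasure D (E i))"
    using P.emeasure_PiM_Collect[of J E] assms by (simp add: W_def cylinder_def)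
  then show ?thesis
    by (simp add: W.emeasure_eq_measure D.emeasure_eq_measure prod_ennreal prod_nonneg)
qed

lemma sets_cylinder:
  assumes "finite J" "\<And>i. i \<in> J \<Longrightarrow> E i \<in> sets D"
  shows "cylinder J E \<in> sets W"
proof -
  have "{w \<in> space W. w i \<in> E i} \<in> sets W" if "i \<in> J" for i
    using measurable_sets[OF measurable_coord assms(2)[OF that], of i]
    by (simp add: vimage_def Int_def conj_commute)
  then show ?thesis
    unfolding cylinder_def by (intro sets.sets_Collect_finite_All assms(1)) auto
qed

definition cylinders :: "(int \<Rightarrow> 'b) set set" where
  "cylinders = {cylinder J E | J E. finite J \<and> (\<forall>i\<in>J. E i \<in> sets D)}"

lemma sets_W_eq: "sets W = sigma_sets (space W) cylinders"
proof (rule antisym)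
  have "prod_algebra UNIV (\<lambda>_. D) \<subseteq> cylinders"
  proof
    fix A assume "A \<in> prod_algebra UNIV (\<lambda>_::int. D)"
    from prod_algebraE[OF this] obtain J E where A: "A = prod_emb UNIV (\<lambda>_. D) J (Pi\<^sub>E J E)"
      and J: "finite J" "\<And>i. i \<in> J \<Longrightarrow> E i \<in> sets D" by metis
    have "A = cylinder J E"
      using sets.sets_into_space[OF J(2)]
      by (auto simp: A cylinder_def prod_emb_def space_W PiE_def extensional_def restrict_def Pi_iff)
    then show "A \<in> cylinders" using J by (auto simp: cylinders_def)
  qed
  then show "sets W \<subseteq> sigma_sets (space W) cylinders"
    unfolding W_def sets_PiM space_PiM by (rule sigma_sets_mono')
  show "sigma_sets (space W) cylinders \<subseteq> sets W"
    by (rule sets.sigma_sets_subset) (auto simp: cylinders_def sets_cylinder)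
qed

lemma cylinder_Int:
  "cylinder J E \<inter> cylinder J' E' = cylinder (J \<union> J')
     (\<lambda>i. (if i \<in> J then E i else space D) \<inter> (if i \<in> J' then E' i else space D))"
  by (auto simp: cylinder_def space_W)

lemma Int_stable_cylinders: "Int_stable cylinders"
proof (rule Int_stableI)
  fix A B assume "A \<in> cylinders" "B \<in> cylinders"
  then obtain J E J' E' where *: "A = cylinder J E" "B = cylinder J' E'" "finite J" "finite J'"
    "\<forall>i\<in>J. E i \<in> sets D" "\<forall>i\<in>J'. E' i \<in> sets D" unfolding cylinders_def by auto
  then show "A \<inter> B \<in> cylinders"
    unfolding cylinders_def
    by (auto simp: cylinder_Int intro!: exI[of _ "J \<union> J'"]
        exI[of _ "\<lambda>i. (if i \<in> J then E i else space D) \<inter> (if i \<in> J' then E' i else space D)"])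
qed

lemma shift_vimage_cylinder:
  "tshift s -` cylinder J E \<inter> space W = cylinder ((\<lambda>i. i + s) ` J) (\<lambda>i. E (i - s))"
  by (auto simp: cylinder_def space_W tshift_def)

text \<open>Once \<open>n\<close> exceeds every distance between an index of one cylinder and an
  index of the other, the shifted index set is disjoint from the first and the product measure
  factorizes exactly.\<close>

lemma mixing_cylinders:
  assumes s: "s \<noteq> 0" and A: "A \<in> cylinders" and B: "B \<in> cylinders"
  shows "\<forall>\<^sub>F n in sequentially.
    measure W (A \<inter> (tshift (s * int n) -` B \<inter> space W)) = measure W A * measure W B"
proof -
  obtain J E J' E' where *: "A = cylinder J E" "B = cylinder J' E'" "finite J" "finite J'"
    "\<And>i. i \<in> J \<Longrightarrow> E i \<in> sets D" "\<And>i. i \<in> J' \<Longrightarrow> E' i \<in> sets D"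
    using A B unfolding cylinders_def by auto
  have fin: "finite ((\<lambda>(i, j). nat \<bar>i - j\<bar>) ` (J \<times> J'))" using * by simp
  obtain N where "\<forall>x \<in> (\<lambda>(i, j). nat \<bar>i - j\<bar>) ` (J \<times> J'). x \<le> N"
    using fin[unfolded finite_nat_set_iff_bounded_le] by blast
  then have N: "\<And>i j. i \<in> J \<Longrightarrow> j \<in> J' \<Longrightarrow> nat \<bar>i - j\<bar> \<le> N" by force
  have "measure W (A \<inter> (tshift (s * int n) -` B \<inter> space W)) = measure W A * measure W B" if n: "n > N" for n
  proof -
    let ?J' = "(\<lambda>i. i + s * int n) ` J'"
    have disj: "J \<inter> ?J' = {}"
    proof safe
      fix j assume j: "j \<in> J'" "j + s * int n \<in> J"
      have "nat \<bar>s * int n\<bar> \<le> N" using N[OF j(2,1)] by simp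
      moreover have "\<bar>s * int n\<bar> \<ge> 1 * int n" unfolding abs_mult using s by (intro mult_mono) auto
      ultimately show "j + s * int n \<in> {}" using n by linarith
    qed
    have fJ': "finite ?J'" using * by simp
    let ?F = "\<lambda>i. (if i \<in> J then E i else space D) \<inter> (if i \<in> ?J' then E' (i - s * int n) else space D)"
    have "measure W (A \<inter> (tshift (s * int n) -` B \<inter> space W)) = measure W (cylinder (J \<union> ?J') ?F)"
      unfolding *(1,2) shift_vimage_cylinder cylinder_Int ..
    also have "\<dots> = (\<Prod>i\<in>J \<union> ?J'. measure D (?F i))"
      by (rule prob_cylinder) (use * fJ' in auto)
    also have "\<dots> = (\<Prod>i\<in>J. measure D (?F i)) * (\<Prod>i\<in>?J'. measure D (?F i))"
      by (rule prod.union_disjoint) (use * fJ' disj in auto)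
    also have "(\<Prod>i\<in>J. measure D (?F i)) = (\<Prod>i\<in>J. measure D (E i))"
    proof (rule prod.cong[OF refl])
      fix i assume i: "i \<in> J"
      then have "?F i = E i" using disj sets.sets_into_space[OF *(5)[OF i]] by auto
      then show "measure D (?F i) = measure D (E i)" by simp
    qed
    also have "(\<Prod>i\<in>?J'. measure D (?F i)) = (\<Prod>i\<in>?J'. measure D (E' (i - s * int n)))"
    proof (rule prod.cong[OF refl])
      fix i assume i: "i \<in> ?J'"
      then have "i - s * int n \<in> J'" by auto
      then have "?F i = E' (i - s * int n)"
        using i disj sets.sets_into_space[OF *(6), of "i - s * int n"] by auto
      then show "measure D (?F i) = measure D (E' (i - s * int n))" by simp
    qed
    also have "\<dots> = (\<Prod>i\<in>J'. measure D (E' i))"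
      by (subst prod.reindex) (auto simp: inj_on_def)
    finally show ?thesis using * by (simp add: prob_cylinder)
  qed
  then show ?thesis by (intro eventually_sequentiallyI[of "Suc N"]) simp
qed

text \<open>Dominated convergence for series: the terms are bounded by
  \<open>measure W (A i)\<close>, which is summable and does not depend on \<open>n\<close>.\<close>

lemma tendsto_measure_UN_Int:
  fixes A :: "nat \<Rightarrow> (int \<Rightarrow> 'b) set" and B :: "nat \<Rightarrow> (int \<Rightarrow> 'b) set"
  assumes d: "disjoint_family A" and A: "\<And>i. A i \<in> sets W" and B: "\<And>n. B n \<in> sets W"
    and lim: "\<And>i. (\<lambda>n. measure W (A i \<inter> B n)) \<longlonglongrightarrow> measure W (A i) * c"
  shows "(\<lambda>n. measure W ((\<Union>i. A i) \<inter> B n)) \<longlonglongrightarrow> measure W (\<Union>i. A i) * c"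
proof -
  have s: "(\<lambda>i. measure W (A i)) sums measure W (\<Union>i. A i)"
    using A d by (intro W.finite_measure_UNION) auto
  have sB: "(\<lambda>i. measure W (A i \<inter> B n)) sums measure W ((\<Union>i. A i) \<inter> B n)" for n
  proof -
    have "(\<lambda>i. measure W (A i \<inter> B n)) sums measure W (\<Union>i. A i \<inter> B n)"
    proof (rule W.finite_measure_UNION)
      show "disjoint_family (\<lambda>i. A i \<inter> B n)"
        using d unfolding disjoint_family_on_def by blast
    qed (use A B in auto)
    then show ?thesis by (simp add: Int_UN_distrib2 Int_commute)
  qed
  have "(\<lambda>n. \<Sum>i. measure W (A i \<inter> B n)) \<longlonglongrightarrow> (\<Sum>i. measure W (A i) * c)"
  proof (rule tannerys_theorem[THEN conjunct2, THEN conjunct2])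
    show "summable (\<lambda>i. measure W (A i))" using s by (simp add: sums_iff)
    show "\<forall>\<^sub>F (i, n) in sequentially \<times>\<^sub>F sequentially. norm (measure W (A i \<inter> B n)) \<le> measure W (A i)"
      using A B by (intro always_eventually) (auto intro!: W.finite_measure_mono)
  qed (use lim in auto)
  then show ?thesis
    using s sB by (simp add: sums_iff suminf_mult2[symmetric])
qed

text \<open>Two nested inductions over the generated sigma-algebra: first the set \<open>A\<close>
  is freed with \<open>B\<close> a cylinder, then \<open>B\<close> is freed with \<open>A\<close> an
  arbitrary measurable set.\<close>

lemma mixing:
  assumes s: "s \<noteq> 0" and A: "A \<in> sets W" and B: "B \<in> sets W"
  shows "(\<lambda>n. measure W (A \<inter> (tshift (s * int n) -` B \<inter> space W))) \<longlonglongrightarrow> measure W A * measure W B"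
proof -
  have sub: "cylinders \<subseteq> Pow (space W)" by (auto simp: cylinders_def cylinder_def)
  have cyl: "C \<in> cylinders \<Longrightarrow> C \<in> sets W" for C by (auto simp: cylinders_def sets_cylinder)
  have vi: "C \<in> sets W \<Longrightarrow> tshift t -` C \<inter> space W \<in> sets W" for C t by (rule measurable_sets[OF measurable_shift])
  have one: "(\<lambda>n. measure W (A \<inter> (tshift (s * int n) -` B \<inter> space W))) \<longlonglongrightarrow> measure W A * measure W B"
    if B: "B \<in> cylinders" and A: "A \<in> sigma_sets (space W) cylinders" for A B
    using Int_stable_cylinders sub A
  proof (induction rule: sigma_sets_induct_disjoint)
    case (basic A)
    show ?case using mixing_cylinders[OF s basic B] by (rule tendsto_eventually)
  next
    case (compl A)
    then have A: "A \<in> sets W" by (simp add: sets_W_eq)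
    have Bm: "B \<in> sets W" using B cyl by simp
    have "measure W ((space W - A) \<inter> (tshift t -` B \<inter> space W))
      = measure W B - measure W (A \<inter> (tshift t -` B \<inter> space W))" for t
    proof -
      have "(space W - A) \<inter> (tshift t -` B \<inter> space W)
        = (tshift t -` B \<inter> space W) - (A \<inter> (tshift t -` B \<inter> space W))" by auto
      then show ?thesis
        using A vi[OF Bm, of t] prob_shift_vimage[OF Bm, of t]
        by (subst \<open>_ = _ - _\<close>, subst W.finite_measure_Diff) auto
    qed
    then show ?case
      using compl tendsto_diff[OF tendsto_const compl(2), of "measure W B"] W.prob_compl[OF A]
      by (simp add: left_diff_distrib)
  next
    case (union A)
    then show ?case
      using vi[OF cyl[OF B]] by (intro tendsto_measure_UN_Int) (auto simp: sets_W_eq)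
  qed simp
  show ?thesis
    using Int_stable_cylinders sub B[unfolded sets_W_eq]
  proof (induction rule: sigma_sets_induct_disjoint)
    case (basic B)
    then show ?case using one A by (simp add: sets_W_eq)
  next
    case (compl B)
    then have Bm: "B \<in> sets W" by (simp add: sets_W_eq)
    have "measure W (A \<inter> (tshift t -` (space W - B) \<inter> space W))
      = measure W A - measure W (A \<inter> (tshift t -` B \<inter> space W))" for t
    proof -
      have "A \<inter> (tshift t -` (space W - B) \<inter> space W) = A - (A \<inter> (tshift t -` B \<inter> space W))"
        using sets.sets_into_space[OF A] shift_in_space by blast
      then show ?thesis
        using A vi[OF Bm, of t] by (subst \<open>_ = _ - _\<close>, subst W.finite_measure_Diff) auto
    qed
    then show ?case
      using compl tendsto_diff[OF tendsto_const compl(2), of "measure W A"] W.prob_compl[OF Bm]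
      by (simp add: right_diff_distrib)
  next
    case (union B)
    have Bm: "B i \<in> sets W" for i using union by (auto simp: sets_W_eq)
    have s: "(\<lambda>i. measure W (B i)) sums measure W (\<Union>i. B i)"
      using Bm union by (intro W.finite_measure_UNION) auto
    have sB: "(\<lambda>i. measure W (A \<inter> (tshift t -` B i \<inter> space W)))
        sums measure W (A \<inter> (tshift t -` (\<Union>i. B i) \<inter> space W))" for t
    proof -
      have "(\<lambda>i. measure W (A \<inter> (tshift t -` B i \<inter> space W)))
          sums measure W (\<Union>i. A \<inter> (tshift t -` B i \<inter> space W))"
        using A vi[OF Bm, of t] union(1)
        by (intro W.finite_measure_UNION) (auto simp: disjoint_family_on_def)
      moreover have "(\<Union>i. A \<inter> (tshift t -` B i \<inter> space W)) = A \<inter> (tshift t -` (\<Union>i. B i) \<inter> space W)" by auto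
      ultimately show ?thesis by simp
    qed
    have "(\<lambda>n. \<Sum>i. measure W (A \<inter> (tshift (s * int n) -` B i \<inter> space W))) \<longlonglongrightarrow> (\<Sum>i. measure W A * measure W (B i))"
    proof (rule tannerys_theorem[THEN conjunct2, THEN conjunct2])
      show "summable (\<lambda>i. measure W (B i))" using s by (simp add: sums_iff)
      have "measure W (A \<inter> (tshift t -` B i \<inter> space W)) \<le> measure W (B i)" for t i
        unfolding prob_shift_vimage[OF Bm, of t i, symmetric]
        using vi[OF Bm] by (intro W.finite_measure_mono) auto
      then show "\<forall>\<^sub>F (i, n) in sequentially \<times>\<^sub>F sequentially.
          norm (measure W (A \<inter> (tshift (s * int n) -` B i \<inter> space W))) \<le> measure W (B i)"
        by (intro always_eventually) auto
    qed (use union in auto)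
    then show ?case
      using s sB by (simp add: sums_iff suminf_mult)
  qed simp
qed

text \<open>For an invariant set the sequence in \<open>mixing\<close> is constant, so its
  probability equals its own square.\<close>

lemma shift_ergodic:
  assumes s: "s \<noteq> 0" and A: "A \<in> sets W" and inv: "tshift s -` A \<inter> space W = A"
  shows "measure W A = 0 \<or> measure W A = 1"
proof -
  have "tshift (s * int n) -` A \<inter> space W = A" for n
  proof -
    have "tshift (s * int n) w \<in> A \<longleftrightarrow> w \<in> A" if "w \<in> space W" for w
    proof (induction n)
      case (Suc n)
      have "tshift (s * int (Suc n)) w \<in> A \<longleftrightarrow> tshift s (tshift (s * int n) w) \<in> A"
        by (simp add: algebra_simps)
      also have "\<dots> \<longleftrightarrow> tshift (s * int n) w \<in> A"
        using inv shift_in_space[OF that] by blast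
      finally show ?case using Suc by simp
    qed simp
    then show ?thesis using sets.sets_into_space[OF A] by auto
  qed
  then have "measure W A = measure W A * measure W A"
    using mixing[OF s A A] by (simp add: LIMSEQ_const_iff)
  then show ?thesis by simp
qed

lemma shift_sums_bounded:
  fixes f :: "(int \<Rightarrow> 'b) \<Rightarrow> real"
  assumes "s \<noteq> 0" "integrable W f" "integral\<^sup>L W f < 0"
  shows "AE w in W. \<exists>C. \<forall>n. (\<Sum>t<n. f (tshift (s * int t) w)) \<le> C"
  using W.ergodic_sums_bounded[OF measurable_shift distr_shift shift_ergodic[OF assms(1)] assms(2,3)]
  by (simp add: funpow_tshift)

section \<open>Resampling the innovation at time 0\<close>

lemma resample_0: "distr (D \<Otimes>\<^sub>M W) W (\<lambda>(z, w). w(0 := z)) = W"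
proof -
  have m: "(\<lambda>(z, w). w(0 := z)) \<in> measurable (D \<Otimes>\<^sub>M W) W"
    by (rule measurable_W_I) (auto simp: split_beta' intro!: measurable_If)
  interpret pair_prob_space D W ..
  have "distr (D \<Otimes>\<^sub>M W) W (\<lambda>(z, w). w(0 := z)) = PiM UNIV (\<lambda>_. D)"
  proof (rule P.PiM_eq)
    fix J :: "int set" and F assume J: "finite J" "\<And>j. j \<in> J \<Longrightarrow> F j \<in> sets D"
    let ?G = "if 0 \<in> J then F 0 else space D"
    have eq: "prod_emb UNIV (\<lambda>_. D) J (Pi\<^sub>E J F) = cylinder J F"
      using sets.sets_into_space[OF J(2)]
      by (auto simp: cylinder_def prod_emb_def space_W PiE_def extensional_def restrict_def Pi_iff)
    \<comment> \<open>The preimage of a cylinder is a rectangle: the condition on coordinate 0 falls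
      on the fresh draw, all others on the path.\<close>
    have "(\<lambda>(z, w). w(0 := z)) -` cylinder J F \<inter> space (D \<Otimes>\<^sub>M W) = ?G \<times> cylinder (J - {0}) F"
      using sets.sets_into_space[OF J(2)]
      by (auto simp: cylinder_def space_W space_pair_measure subset_iff split: if_splits)
    then have "emeasure (distr (D \<Otimes>\<^sub>M W) W (\<lambda>(z, w). w(0 := z))) (cylinder J F)
        = emeasure D ?G * emeasure W (cylinder (J - {0}) F)"
    proof -
      have "?G \<in> sets D" "cylinder (J - {0}) F \<in> sets W" using J by (auto intro: sets_cylinder)
      then have "emeasure (D \<Otimes>\<^sub>M W) (?G \<times> cylinder (J - {0}) F)
          = emeasure D ?G * emeasure W (cylinder (J - {0}) F)"
        by (rule W.emeasure_pair_measure_Times)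
      then show ?thesis
        using J m \<open>_ = ?G \<times> _\<close> by (subst emeasure_distr) (auto intro: sets_cylinder)
    qed
    also have "\<dots> = (\<Prod>j\<in>J. emeasure D (F j))"
    proof -
      have "emeasure W (cylinder (J - {0}) F) = (\<Prod>j\<in>J-{0}. emeasure D (F j))"
        using J prob_cylinder[of "J - {0}" F]
        by (simp add: W.emeasure_eq_measure D.emeasure_eq_measure prod_ennreal prod_nonneg)
      then show ?thesis
        using J by (simp add: D.emeasure_space_1 prod.remove)
    qed
    finally show "emeasure (distr (D \<Otimes>\<^sub>M W) W (\<lambda>(z, w). w(0 := z))) (prod_emb UNIV (\<lambda>_. D) J (Pi\<^sub>E J F))
      = (\<Prod>j\<in>J. emeasure D (F j))" by (simp add: eq)
  qed (simp add: W_def)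
  then show ?thesis by (simp add: W_def)
qed

lemma measurable_resample [measurable]: "(\<lambda>(z, w). w(0 := z)) \<in> measurable (D \<Otimes>\<^sub>M W) W"
  by (rule measurable_W_I) (auto simp: split_beta' intro!: measurable_If)

lemma nn_integral_resample:
  assumes f: "f \<in> borel_measurable W"
  shows "(\<integral>\<^sup>+w. f w \<partial>W) = (\<integral>\<^sup>+w. (\<integral>\<^sup>+z. f (w(0 := z)) \<partial>D) \<partial>W)"
proof -
  interpret pair_sigma_finite D W ..
  have m: "(\<lambda>(z, w). f (w(0 := z))) \<in> borel_measurable (D \<Otimes>\<^sub>M W)"
    using measurable_compose[OF measurable_resample f] by (simp add: split_beta')
  have "(\<integral>\<^sup>+w. f w \<partial>W) = (\<integral>\<^sup>+p. f (case p of (z, w) \<Rightarrow> w(0 := z)) \<partial>(D \<Otimes>\<^sub>M W))"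
    by (subst resample_0[symmetric], subst nn_integral_distr) (use f in auto)
  also have "\<dots> = (\<integral>\<^sup>+w. (\<integral>\<^sup>+z. f (w(0 := z)) \<partial>D) \<partial>W)"
    using nn_integral_snd[OF m] by (simp add: split_beta')
  finally show ?thesis .
qed

text \<open>The factors are swapped because the fresh innovation must be the inner variable: for
  almost every path, the statement then concerns the law \<open>D\<close> alone.\<close>

lemma AE_resample:
  assumes "AE w in W. P w"
  shows "AE w in W. AE z in D. P (w(0 := z))"
proof -
  interpret pair_sigma_finite D W ..
  interpret WD: pair_sigma_finite W D ..
  have "AE p in D \<Otimes>\<^sub>M W. P (case p of (z, w) \<Rightarrow> w(0 := z))"
    by (rule AE_distrD[OF measurable_resample, of P]) (subst resample_0, rule assms)
  then have "AE p in distr (W \<Otimes>\<^sub>M D) (D \<Otimes>\<^sub>M W) (\<lambda>(x, y). (y, x)). P (case p of (z, w) \<Rightarrow> w(0 := z))"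
    unfolding distr_pair_swap[symmetric] .
  then have "AE p in W \<Otimes>\<^sub>M D. P (case (case p of (x, y) \<Rightarrow> (y, x)) of (z, w) \<Rightarrow> w(0 := z))"
    by (rule AE_distrD[rotated]) simp
  then have "AE p in W \<Otimes>\<^sub>M D. P (case p of (w, z) \<Rightarrow> w(0 := z))"
    by (simp add: split_beta')
  then show ?thesis
    using WD.AE_pair[of "\<lambda>p. P (case p of (w, z) \<Rightarrow> w(0 := z))"] by simp
qed

end

section \<open>The volatility recursion on a compact parameter set\<close>

definition news :: "egarch_param \<Rightarrow> real \<Rightarrow> real" where
  "news th x = par_gamma th * x + par_delta th * \<bar>x\<bar>"

definition egarch_step :: "egarch_param \<Rightarrow> real \<Rightarrow> real \<Rightarrow> real" where
  "egarch_step th x v = par_alpha th + par_beta th * v + news th x * exp (- v / 2)"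

text \<open>The fixed point of the affine map that remains of \<open>egarch_step\<close> when the
  news vanishes; nonnegative news makes the half-line above it invariant.\<close>

definition egarch_lo :: "egarch_param \<Rightarrow> real" where
  "egarch_lo th = par_alpha th / (1 - par_beta th)"

text \<open>The value at time \<open>t\<close> of the recursion started \<open>k\<close> steps
  earlier at \<open>egarch_lo th\<close>. Starting at the fixed point keeps all iterates in the
  region of contraction.\<close>

fun egarch_back :: "egarch_param \<Rightarrow> (int \<Rightarrow> real) \<Rightarrow> nat \<Rightarrow> int \<Rightarrow> real" where
  "egarch_back th x 0 t = egarch_lo th"
| "egarch_back th x (Suc k) t = egarch_step th (x (t - 1)) (egarch_back th x k (t - 1))"

text \<open>The candidate for the stationary solution. As a total function of the path it is
  measurable without restriction; the limit is known to exist under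
  \<open>good_past\<close>.\<close>

definition egarch_h :: "egarch_param \<Rightarrow> (int \<Rightarrow> real) \<Rightarrow> int \<Rightarrow> real" where
  "egarch_h th x t = lim (\<lambda>k. egarch_back th x k t)"

text \<open>Minus twice the contribution of one observation to the quasi-likelihood, so maximizing
  the likelihood means minimizing the summed loss.\<close>

definition egarch_loss :: "real \<Rightarrow> real \<Rightarrow> real" where
  "egarch_loss x v = x\<^sup>2 / exp v + v"

section \<open>Growth and decay rates of real sequences\<close>

definition subexp :: "(nat \<Rightarrow> real) \<Rightarrow> bool" where
  "subexp u \<longleftrightarrow> (\<forall>\<epsilon>>0. \<exists>C. \<forall>n. \<bar>u n\<bar> \<le> C * exp (\<epsilon> * real n))"

text \<open>Decay asks for some rate, \<open>subexp\<close> for a bound at every rate; hence a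
  decaying sequence stays decaying after multiplication by any subexponential one.\<close>

definition exp_decay :: "(nat \<Rightarrow> real) \<Rightarrow> bool" where
  "exp_decay u \<longleftrightarrow> (\<exists>\<kappa>>0. \<exists>C. \<forall>n. \<bar>u n\<bar> \<le> C * exp (- \<kappa> * real n))"

lemma exp_decay_mult_subexp:
  assumes "exp_decay u" "subexp v" shows "exp_decay (\<lambda>n. u n * v n)"
proof -
  obtain \<kappa> C where *: "\<kappa> > 0" "\<And>n. \<bar>u n\<bar> \<le> C * exp (- \<kappa> * real n)" using assms unfolding exp_decay_def by auto
  obtain C' where **: "\<And>n. \<bar>v n\<bar> \<le> C' * exp (\<kappa> / 2 * real n)"
    using assms(2) *(1) unfolding subexp_def by (meson half_gt_zero)
  have "\<bar>u n * v n\<bar> \<le> (C * C') * exp (- (\<kappa> / 2) * real n)" for n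
  proof -
    have "\<bar>u n * v n\<bar> \<le> (C * exp (- \<kappa> * real n)) * (C' * exp (\<kappa> / 2 * real n))"
      unfolding abs_mult using *(2)[of n] **[of n] by (intro mult_mono) (auto intro: order_trans[OF abs_ge_zero])
    also have "\<dots> = (C * C') * (exp (- \<kappa> * real n) * exp (\<kappa> / 2 * real n))" by simp
    also have "exp (- \<kappa> * real n) * exp (\<kappa> / 2 * real n) = exp (- (\<kappa> / 2) * real n)"
      by (simp add: exp_add[symmetric])
    finally show ?thesis .
  qed
  then show ?thesis unfolding exp_decay_def using *(1) by (intro exI[of _ "\<kappa>/2"]) auto
qed

lemma subexp_mult:
  assumes "subexp u" "subexp v" shows "subexp (\<lambda>n. u n * v n)"
  unfolding subexp_def
proof safe
  fix \<epsilon> :: real assume "\<epsilon> > 0"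
  then obtain C C' where *: "\<And>n. \<bar>u n\<bar> \<le> C * exp (\<epsilon> / 2 * real n)" "\<And>n. \<bar>v n\<bar> \<le> C' * exp (\<epsilon> / 2 * real n)"
    using assms unfolding subexp_def by (meson half_gt_zero)
  have "\<bar>u n * v n\<bar> \<le> (C * C') * exp (\<epsilon> * real n)" for n
  proof -
    have "\<bar>u n * v n\<bar> \<le> (C * exp (\<epsilon> / 2 * real n)) * (C' * exp (\<epsilon> / 2 * real n))"
      unfolding abs_mult using *[of n] by (intro mult_mono) (auto intro: order_trans[OF abs_ge_zero])
    also have "\<dots> = (C * C') * (exp (\<epsilon> / 2 * real n) * exp (\<epsilon> / 2 * real n))" by simp
    also have "exp (\<epsilon> / 2 * real n) * exp (\<epsilon> / 2 * real n) = exp (\<epsilon> * real n)"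
      by (simp add: exp_add[symmetric])
    finally show ?thesis .
  qed
  then show "\<exists>C. \<forall>n. \<bar>u n * v n\<bar> \<le> C * exp (\<epsilon> * real n)" by blast
qed

lemma subexp_const: "subexp (\<lambda>_. c)"
  unfolding subexp_def by (auto intro!: exI[of _ "\<bar>c\<bar>"] simp: mult_le_cancel_left1)

lemma subexp_add:
  assumes "subexp u" "subexp v" shows "subexp (\<lambda>n. u n + v n)"
  unfolding subexp_def
proof safe
  fix \<epsilon> :: real assume "\<epsilon> > 0"
  then obtain C C' where *: "\<And>n. \<bar>u n\<bar> \<le> C * exp (\<epsilon> * real n)" "\<And>n. \<bar>v n\<bar> \<le> C' * exp (\<epsilon> * real n)"
    using assms unfolding subexp_def by meson
  have "\<bar>u n + v n\<bar> \<le> (C + C') * exp (\<epsilon> * real n)" for n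
    using *[of n] by (simp add: distrib_right)
  then show "\<exists>C. \<forall>n. \<bar>u n + v n\<bar> \<le> C * exp (\<epsilon> * real n)" by blast
qed

lemma exp_decay_summable:
  assumes "exp_decay u" shows "summable (\<lambda>n. \<bar>u n\<bar>)"
proof -
  obtain \<kappa> C where *: "\<kappa> > 0" "\<And>n. \<bar>u n\<bar> \<le> C * exp (- \<kappa> * real n)" using assms unfolding exp_decay_def by auto
  have "summable (\<lambda>n. C * exp (- \<kappa>) ^ n)" using *(1) by (intro summable_mult summable_geometric) auto
  then show ?thesis
    by (rule summable_comparison_test') (use *(2) in \<open>auto simp: exp_of_nat_mult[symmetric] mult.commute\<close>)
qed

lemma exp_decay_mono:
  assumes "exp_decay u" "\<And>n. \<bar>v n\<bar> \<le> \<bar>u n\<bar>" shows "exp_decay v"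
  using assms unfolding exp_decay_def by (meson order_trans)

lemma exp_decay_cmult:
  assumes "exp_decay u" shows "exp_decay (\<lambda>n. c * u n)"
  using exp_decay_mult_subexp[OF assms subexp_const[of c]] by (simp add: mult.commute)

lemma exp_decay_tendsto_0:
  assumes "exp_decay u" shows "u \<longlonglongrightarrow> 0"
  using summable_LIMSEQ_zero[OF exp_decay_summable[OF assms]] by (simp add: tendsto_rabs_zero_iff)

lemma continuous_par [continuous_intros]:
  "continuous_on A par_alpha" "continuous_on A par_beta" "continuous_on A par_gamma" "continuous_on A par_delta"
  unfolding par_alpha_def[abs_def] par_beta_def[abs_def] par_gamma_def[abs_def] par_delta_def[abs_def]
  by (intro continuous_intros)+

text \<open>Factor out \<open>exp (- c * v')\<close> and bound the remaining exponential from below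
  by its tangent at 0.\<close>

lemma exp_neg_diff_le:
  fixes c v v' :: real
  assumes "c > 0" "v' \<le> v" shows "exp (- c * v') - exp (- c * v) \<le> c * exp (- c * v') * (v - v')"
proof -
  have "exp (- c * v) = exp (- c * v') * exp (- c * (v - v'))"
    by (simp add: exp_add[symmetric] algebra_simps)
  moreover have "exp (- c * (v - v')) \<ge> 1 - c * (v - v')" using exp_ge_add_one_self[of "- c * (v - v')"] by simp
  ultimately have "exp (- c * v) \<ge> exp (- c * v') * (1 - c * (v - v'))" by simp
  then show ?thesis by (simp add: algebra_simps)
qed

section \<open>Contraction of the volatility step on a compact parameter set\<close>

locale egarch_compact =
  fixes K :: "egarch_param set"
  assumes K_compact: "compact K" and K_sub: "K \<subseteq> egarch_space" and K_ne: "K \<noteq> {}"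
begin

lemma K_D:
  assumes "th \<in> K"
  shows "0 \<le> par_beta th" "par_beta th < 1" "\<bar>par_gamma th\<bar> \<le> par_delta th"
  using assms K_sub by (auto simp: egarch_space_def)

lemma continuous_K_bounded:
  fixes f :: "egarch_param \<Rightarrow> real"
  assumes "continuous_on K f"
  obtains B where "B \<ge> 0" "\<And>th. th \<in> K \<Longrightarrow> \<bar>f th\<bar> \<le> B"
proof -
  have "bounded (f ` K)" using assms K_compact by (intro compact_imp_bounded compact_continuous_image)
  then obtain B where "B > 0" "\<forall>v\<in>f ` K. norm v \<le> B" unfolding bounded_pos by blast
  then show ?thesis by (intro that[of B]) auto
qed

text \<open>Compactness keeps \<open>par_beta\<close> uniformly away from 1, so that errors of size
  \<open>b ^ t\<close> are summable uniformly in the parameter.\<close>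

lemma beta_bound: obtains b where "0 \<le> b" "b < 1" "\<And>th. th \<in> K \<Longrightarrow> par_beta th \<le> b"
proof -
  obtain th where "th \<in> K" "\<forall>y\<in>K. par_beta y \<le> par_beta th"
    using continuous_attains_sup[OF K_compact K_ne continuous_par(2)] by blast
  then show ?thesis using that[of "par_beta th"] K_D by blast
qed

lemma continuous_lo [continuous_intros]: "continuous_on K egarch_lo"
  unfolding egarch_lo_def[abs_def] by (intro continuous_intros ballI) (metis K_D(2) diff_gt_0_iff_gt less_irrefl)

lemma m_le_lo: "th \<in> K \<Longrightarrow> egarch_m K \<le> egarch_lo th"
proof -
  assume "th \<in> K"
  obtain B where "\<And>th. th \<in> K \<Longrightarrow> \<bar>egarch_lo th\<bar> \<le> B" using continuous_K_bounded[OF continuous_lo] by blast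
  then have "- B \<le> egarch_lo th" if "th \<in> K" for th
    using that by (meson abs_le_D2 minus_le_iff)
  then have "bdd_below (egarch_lo ` K)" by (rule bdd_belowI2)
  then show ?thesis using \<open>th \<in> K\<close> unfolding egarch_m_def egarch_lo_def[symmetric] by (rule cINF_lower)
qed

lemma news_nonneg:
  assumes "th \<in> K" shows "0 \<le> news th x"
proof -
  have "\<bar>par_gamma th * x\<bar> \<le> par_delta th * \<bar>x\<bar>"
    unfolding abs_mult by (rule mult_right_mono[OF K_D(3)[OF assms]]) simp
  then show ?thesis unfolding news_def by linarith
qed

lemma news_lipschitz: "\<exists>B. 0 \<le> B \<and> (\<forall>th\<in>K. \<forall>x y. \<bar>news th x - news th y\<bar> \<le> B * \<bar>x - y\<bar>)"
proof -
  obtain B where B: "B \<ge> 0" "\<And>th. th \<in> K \<Longrightarrow> \<bar>par_delta th\<bar> \<le> B"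
    using continuous_K_bounded[OF continuous_par(4)] by blast
  have lip: "\<bar>news th x - news th y\<bar> \<le> (2 * B) * \<bar>x - y\<bar>" if "th \<in> K" for th x y
  proof -
    have "news th x - news th y = par_gamma th * (x - y) + par_delta th * (\<bar>x\<bar> - \<bar>y\<bar>)"
      by (simp add: news_def algebra_simps)
    moreover have "\<bar>par_gamma th * (x - y)\<bar> \<le> B * \<bar>x - y\<bar>"
      unfolding abs_mult using B(2)[OF that] K_D(3)[OF that] by (intro mult_right_mono) auto
    moreover have "\<bar>par_delta th * (\<bar>x\<bar> - \<bar>y\<bar>)\<bar> \<le> B * \<bar>x - y\<bar>"
      unfolding abs_mult using B that by (intro mult_mono) auto
    ultimately show ?thesis by linarith
  qed
  show ?thesis using B lip by (intro exI[of _ "2 * B"]) auto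
qed

text \<open>The slope bound, uniform over \<open>K\<close>. The absolute value inside
  \<open>supK\<close> changes nothing, since \<open>egarch_lambda0\<close> is at least
  \<open>par_beta\<close>, which is nonnegative on \<open>K\<close>.\<close>

definition Lam :: "real \<Rightarrow> real" where
  "Lam x = supK K (\<lambda>th. egarch_lambda0 K th x)"

lemma lambda0_eq: "egarch_lambda0 K th x = max (par_beta th) (1/2 * exp (- egarch_m K / 2) * news th x - par_beta th)"
  by (simp add: egarch_lambda0_def news_def)

lemma lambda0_nonneg: "th \<in> K \<Longrightarrow> 0 \<le> egarch_lambda0 K th x"
  using K_D(1)[of th] by (simp add: lambda0_eq)

lemma bdd_lambda0: "bdd_above ((\<lambda>th. \<bar>egarch_lambda0 K th x\<bar>) ` K)"
proof -
  have "continuous_on K (\<lambda>th. \<bar>max (par_beta th) (c * news th x - par_beta th)\<bar>)" for c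
    unfolding news_def by (intro continuous_on_rabs continuous_on_max continuous_on_diff continuous_on_add
        continuous_on_mult continuous_par continuous_on_const)
  then have "continuous_on K (\<lambda>th. \<bar>egarch_lambda0 K th x\<bar>)"
    unfolding lambda0_eq .
  then show ?thesis
    using K_compact by (intro bounded_imp_bdd_above compact_imp_bounded compact_continuous_image)
qed

lemma lambda0_le_Lam: "th \<in> K \<Longrightarrow> egarch_lambda0 K th x \<le> Lam x"
  unfolding Lam_def supK_def
  by (rule order_trans[OF abs_ge_self cSUP_upper[OF _ bdd_lambda0]])

lemma Lam_nonneg: "0 \<le> Lam x"
proof -
  obtain th where "th \<in> K" using K_ne by blast
  then show ?thesis using lambda0_nonneg[of th x] lambda0_le_Lam[of th x] by linarith
qed

text \<open>A supremum of functions with a common Lipschitz constant is Lipschitz. The purpose is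
  Borel measurability of \<open>Lam\<close>, a supremum over an uncountable set.\<close>

lemma continuous_Lam: "continuous_on UNIV Lam"
proof -
  obtain B where *: "0 \<le> B \<and> (\<forall>th\<in>K. \<forall>x y. \<bar>news th x - news th y\<bar> \<le> B * \<bar>x - y\<bar>)"
    using news_lipschitz by (rule exE)
  then have B: "B \<ge> 0" "\<And>th x y. th \<in> K \<Longrightarrow> \<bar>news th x - news th y\<bar> \<le> B * \<bar>x - y\<bar>"
    by simp_all
  let ?L = "1/2 * exp (- egarch_m K / 2) * B"
  have "Lam x \<le> Lam y + ?L * \<bar>x - y\<bar>" for x y
    unfolding Lam_def[of x] supK_def
  proof (rule cSUP_least[OF K_ne])
    fix th assume th: "th \<in> K"
    have aux: "max p (a - p) \<le> max p (b - p) + e" if "a - b \<le> e" "0 \<le> e" for p a b e :: real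
      using that by auto
    have "1/2 * exp (- egarch_m K / 2) * (news th x - news th y) \<le> 1/2 * exp (- egarch_m K / 2) * (B * \<bar>x - y\<bar>)"
      using B(2)[OF th, of x y] by (intro mult_left_mono) auto
    then have "1/2 * exp (- egarch_m K / 2) * news th x - 1/2 * exp (- egarch_m K / 2) * news th y \<le> ?L * \<bar>x - y\<bar>"
      by (simp only: right_diff_distrib mult.assoc)
    then have "egarch_lambda0 K th x \<le> egarch_lambda0 K th y + ?L * \<bar>x - y\<bar>"
      unfolding lambda0_eq by (rule aux) (use B(1) in simp)
    also have "\<dots> \<le> Lam y + ?L * \<bar>x - y\<bar>" using lambda0_le_Lam[OF th] by simp
    finally show "\<bar>egarch_lambda0 K th x\<bar> \<le> Lam y + ?L * \<bar>x - y\<bar>" using lambda0_nonneg[OF th] by simp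
  qed
  then have "Lam x - Lam y \<le> ?L * \<bar>x - y\<bar>" for x y by (simp only: diff_le_eq add.commute)
  then have "dist (Lam x) (Lam y) \<le> ?L * dist x y" for x y
    unfolding dist_real_def by (metis abs_le_iff abs_minus_commute minus_diff_eq)
  then have "?L-lipschitz_on UNIV Lam" using B(1) by (intro lipschitz_onI) auto
  then show ?thesis by (rule lipschitz_on_continuous_on)
qed

lemma step_ge_lo: "th \<in> K \<Longrightarrow> egarch_lo th \<le> v \<Longrightarrow> egarch_lo th \<le> egarch_step th x v"
proof -
  assume th: "th \<in> K" and v: "egarch_lo th \<le> v"
  have "egarch_lo th = par_alpha th + par_beta th * egarch_lo th"
    using K_D(2)[OF th] by (simp add: egarch_lo_def field_simps)
  also have "\<dots> \<le> par_alpha th + par_beta th * v" using K_D(1)[OF th] v by (simp add: mult_left_mono)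
  finally show ?thesis using mult_nonneg_nonneg[OF news_nonneg[OF th, of x], of "exp (- v / 2)"]
    by (simp add: egarch_step_def)
qed

text \<open>The slack \<^term>\<open>e\<close> is needed because the recursion started at an arbitrary value only
  enters the invariant half-line above \<^term>\<open>egarch_m K\<close> asymptotically.\<close>

lemma step_lipschitz:
  assumes th: "th \<in> K" and e: "e \<ge> 0" and v: "v \<ge> egarch_m K - e" and v': "v' \<ge> egarch_m K - e"
  shows "\<bar>egarch_step th x v - egarch_step th x v'\<bar> \<le> exp e * Lam x * \<bar>v - v'\<bar>"
proof -
  have main: "\<bar>egarch_step th x v - egarch_step th x v'\<bar> \<le> exp e * Lam x * \<bar>v - v'\<bar>"
    if le: "v' \<le> v" and v': "v' \<ge> egarch_m K - e" for v v'
  proof -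
    define d where "d = v - v'"
    define c where "c = news th x"
    define u where "u = 1/2 * exp (- egarch_m K / 2) * c"
    \<comment> \<open>Going below \<open>egarch_m K\<close> by \<open>e\<close> inflates the factor
      \<open>exp (- v' / 2)\<close> by at most \<open>q\<close>.\<close>
    define q where "q = exp (e / 2)"
    define E where "E = exp (- v' / 2) - exp (- v / 2)"
    define l where "l = egarch_lambda0 K th x"
    have l: "l \<ge> par_beta th" "l \<ge> u - par_beta th" "0 \<le> l" "l \<le> Lam x"
      using lambda0_nonneg[OF th] lambda0_le_Lam[OF th] by (auto simp: l_def lambda0_eq u_def c_def)
    have q: "q \<ge> 1" using e by (simp add: q_def)
    have c: "c \<ge> 0" by (simp add: c_def news_nonneg th)
    have d: "d \<ge> 0" using le by (simp add: d_def)
    have E0: "E \<ge> 0" using le by (simp add: E_def)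
    have "E \<le> 1/2 * exp (- v' / 2) * d"
      using exp_neg_diff_le[of "1/2" v' v] le by (simp add: E_def d_def)
    also have "\<dots> \<le> 1/2 * exp (- (egarch_m K - e) / 2) * d"
      using v' d by (intro mult_right_mono) auto
    also have "exp (- (egarch_m K - e) / 2) = exp (- egarch_m K / 2) * q"
      by (simp add: q_def exp_add[symmetric] diff_divide_distrib)
    finally have "c * E \<le> c * (1/2 * (exp (- egarch_m K / 2) * q) * d)" using c by (rule mult_left_mono)
    then have cE: "c * E \<le> q * u * d" by (simp add: u_def algebra_simps)
    have diff: "egarch_step th x v - egarch_step th x v' = par_beta th * d - c * E"
      by (simp add: egarch_step_def d_def c_def E_def algebra_simps)
    have q2: "exp e = q * q" by (simp add: q_def exp_add[symmetric])
    have qq: "q * q \<ge> 2 * q - 1" using sum_squares_ge_zero[of "q - 1" 0] by (simp add: algebra_simps)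
    \<comment> \<open>The inflated upper slope is compared with \<open>l\<close>, which dominates
      both \<open>u - par_beta th\<close> and \<open>par_beta th\<close>;
      \<open>2 * q - 1 \<le> q * q\<close> then turns the loss into the single factor
      \<open>exp e\<close>.\<close>
    have "q * u - par_beta th = q * (u - par_beta th) + (q - 1) * par_beta th" by (simp add: algebra_simps)
    also have "\<dots> \<le> q * l + (q - 1) * l" using q l by (intro add_mono mult_left_mono) auto
    also have "\<dots> = (2 * q - 1) * l" by (simp add: algebra_simps)
    also have "\<dots> \<le> (q * q) * l" using qq l by (intro mult_right_mono) auto
    finally have up: "(q * u - par_beta th) * d \<le> (q * q) * l * d" using d by (intro mult_right_mono)
    have "par_beta th \<le> (q * q) * l"
      using l q qq mult_right_mono[of 1 "q * q" l] by simp
    then have lo: "par_beta th * d \<le> (q * q) * l * d" using d by (intro mult_right_mono)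
    have "\<bar>par_beta th * d - c * E\<bar> \<le> (q * q) * l * d"
      using up lo cE mult_nonneg_nonneg[OF c E0] by (simp add: abs_le_iff algebra_simps)
    also have "\<dots> \<le> (q * q) * Lam x * d" using l d q by (intro mult_right_mono mult_left_mono) auto
    finally show ?thesis unfolding diff q2 using d by (simp add: d_def)
  qed
  show ?thesis
  proof (cases "v' \<le> v")
    case True then show ?thesis using main v' by blast
  next
    case False then show ?thesis using main[of v v'] v by (simp add: abs_minus_commute)
  qed
qed

section \<open>Backward iteration and the stationary solution\<close>

lemma back_ge_lo: "th \<in> K \<Longrightarrow> egarch_lo th \<le> egarch_back th x k t"
  by (induction k arbitrary: t) (auto intro: step_ge_lo)

lemma step_lipschitz':
  assumes "th \<in> K" "v \<ge> egarch_lo th" "v' \<ge> egarch_lo th"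
  shows "\<bar>egarch_step th x v - egarch_step th x v'\<bar> \<le> Lam x * \<bar>v - v'\<bar>"
  using step_lipschitz[of th 0 v v' x] m_le_lo[of th] assms by simp

lemma prod_Lam_Suc: "Lam (x (t - 1)) * (\<Prod>i<k. Lam (x (t - 1 - 1 - int i))) = (\<Prod>i<Suc k. Lam (x (t - 1 - int i)))"
  unfolding prod.lessThan_Suc_shift by (simp add: algebra_simps)

text \<open>Successive iterates differ only in the oldest step, where the fixed point property of
  \<open>egarch_lo th\<close> leaves the news term alone; the \<open>k\<close> later steps contract
  this difference.\<close>

lemma back_diff:
  assumes th: "th \<in> K"
  shows "\<bar>egarch_back th x (Suc k) t - egarch_back th x k t\<bar>
    \<le> (\<Prod>i<k. Lam (x (t - 1 - int i))) * (news th (x (t - 1 - int k)) * exp (- egarch_lo th / 2))"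
proof (induction k arbitrary: t)
  case 0
  have "egarch_lo th = par_alpha th + par_beta th * egarch_lo th"
    using K_D(2)[OF th] by (simp add: egarch_lo_def field_simps)
  then have "egarch_back th x (Suc 0) t - egarch_back th x 0 t = news th (x (t - 1)) * exp (- egarch_lo th / 2)"
    by (simp add: egarch_step_def)
  then show ?case using news_nonneg[OF th] by simp
next
  case (Suc k)
  have "\<bar>egarch_back th x (Suc (Suc k)) t - egarch_back th x (Suc k) t\<bar>
      \<le> Lam (x (t - 1)) * \<bar>egarch_back th x (Suc k) (t - 1) - egarch_back th x k (t - 1)\<bar>"
    unfolding egarch_back.simps(2)[of th x _ t] by (intro step_lipschitz' th back_ge_lo)
  also have "\<dots> \<le> Lam (x (t - 1)) * ((\<Prod>i<k. Lam (x (t - 1 - 1 - int i)))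
      * (news th (x (t - 1 - 1 - int k)) * exp (- egarch_lo th / 2)))"
    by (intro mult_left_mono Suc Lam_nonneg)
  also have "\<dots> = (\<Prod>i<Suc k. Lam (x (t - 1 - int i))) * (news th (x (t - 1 - 1 - int k)) * exp (- egarch_lo th / 2))"
    unfolding prod_Lam_Suc[symmetric] by (simp only: mult.assoc)
  finally have *: "\<bar>egarch_back th x (Suc (Suc k)) t - egarch_back th x (Suc k) t\<bar>
      \<le> (\<Prod>i<Suc k. Lam (x (t - 1 - int i))) * (news th (x (t - 1 - 1 - int k)) * exp (- egarch_lo th / 2))" .
  have eq: "t - 1 - 1 - int k = t - 1 - int (Suc k)" by simp
  show ?case using * unfolding eq .
qed

text \<open>A solution above \<open>egarch_lo th\<close> and the backward iterate follow the same
  recursion from time \<open>t - k\<close> on, so their distance there is contracted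
  \<open>k\<close> times.\<close>

lemma back_solution_diff:
  assumes th: "th \<in> K" and rec: "\<And>t. y (t + 1) = egarch_step th (x t) (y t)" and ge: "\<And>t. y t \<ge> egarch_lo th"
  shows "\<bar>y t - egarch_back th x k t\<bar>
    \<le> (\<Prod>i<k. Lam (x (t - 1 - int i))) * \<bar>y (t - int k) - egarch_lo th\<bar>"
proof (induction k arbitrary: t)
  case 0
  show ?case by simp
next
  case (Suc k)
  have "y t = egarch_step th (x (t - 1)) (y (t - 1))" using rec[of "t - 1"] by simp
  then have "\<bar>y t - egarch_back th x (Suc k) t\<bar> \<le> Lam (x (t - 1)) * \<bar>y (t - 1) - egarch_back th x k (t - 1)\<bar>"
    by (simp only: egarch_back.simps step_lipschitz'[OF th ge back_ge_lo[OF th]])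
  also have "\<dots> \<le> Lam (x (t - 1)) * ((\<Prod>i<k. Lam (x (t - 1 - 1 - int i))) * \<bar>y (t - 1 - int k) - egarch_lo th\<bar>)"
    by (intro mult_left_mono Suc Lam_nonneg)
  also have "\<dots> = (\<Prod>i<Suc k. Lam (x (t - 1 - int i))) * \<bar>y (t - 1 - int k) - egarch_lo th\<bar>"
    unfolding prod_Lam_Suc[symmetric] by (simp only: mult.assoc)
  finally have *: "\<bar>y t - egarch_back th x (Suc k) t\<bar>
      \<le> (\<Prod>i<Suc k. Lam (x (t - 1 - int i))) * \<bar>y (t - 1 - int k) - egarch_lo th\<bar>" .
  have eq: "t - 1 - int k = t - int (Suc k)" by simp
  show ?case using * unfolding eq .
qed

text \<open>The two pathwise properties from which everything about the stationary solution at time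
  \<open>t\<close> is deduced without probability. The index \<open>t - 1\<close> is the latest
  observation that enters the volatility at time \<open>t\<close>.\<close>

definition good_past :: "(int \<Rightarrow> real) \<Rightarrow> int \<Rightarrow> bool" where
  "good_past x t \<longleftrightarrow> exp_decay (\<lambda>k. \<Prod>i<k. Lam (x (t - 1 - int i))) \<and> subexp (\<lambda>k. x (t - 1 - int k))"

text \<open>Weierstrass M-test for the telescoping series of \<open>back_diff\<close>. The majorant
  is free of the parameter because \<open>news th x\<close> is at most a constant times
  \<open>\<bar>x\<bar>\<close> and \<open>exp (- egarch_lo th / 2)\<close> is bounded on
  \<open>K\<close>.\<close>

lemma back_uniform_limit:
  assumes "good_past x t"
  shows "uniform_limit K (\<lambda>k th. egarch_back th x k t) (\<lambda>th. egarch_h th x t) sequentially"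
proof -
  obtain B where *: "0 \<le> B \<and> (\<forall>th\<in>K. \<forall>x y. \<bar>news th x - news th y\<bar> \<le> B * \<bar>x - y\<bar>)"
    using news_lipschitz by (rule exE)
  have B: "B \<ge> 0" using * by simp
  have news_le: "news th x \<le> B * \<bar>x\<bar>" if "th \<in> K" for th x
  proof -
    have "\<bar>news th x - news th 0\<bar> \<le> B * \<bar>x - 0\<bar>" using * that by blast
    then show ?thesis by (simp add: news_def)
  qed
  have "continuous_on K (\<lambda>th. exp (- egarch_lo th / 2))" by (intro continuous_intros) auto
  then obtain B' where B': "B' \<ge> 0" "\<And>th. th \<in> K \<Longrightarrow> \<bar>exp (- egarch_lo th / 2)\<bar> \<le> B'"
    using continuous_K_bounded by blast
  define P where "P k = (\<Prod>i<k. Lam (x (t - 1 - int i)))" for k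
  define b where "b k = \<bar>(B * B') * (P k * x (t - 1 - int k))\<bar>" for k
  have P0: "P k \<ge> 0" for k unfolding P_def by (intro prod_nonneg) (simp add: Lam_nonneg)
  have bound: "norm (egarch_back th x (Suc k) t - egarch_back th x k t) \<le> b k" if th: "th \<in> K" for th k
  proof -
    have "\<bar>egarch_back th x (Suc k) t - egarch_back th x k t\<bar> \<le> P k * (news th (x (t - 1 - int k)) * exp (- egarch_lo th / 2))"
      unfolding P_def by (rule back_diff[OF th])
    also have "\<dots> \<le> P k * ((B * \<bar>x (t - 1 - int k)\<bar>) * B')"
      using B news_le[OF th] B'(2)[OF th] P0 by (intro mult_left_mono mult_mono) auto
    also have "\<dots> = b k" using P0[of k] B B'(1) by (simp add: b_def abs_mult)
    finally show ?thesis by simp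
  qed
  have "exp_decay (\<lambda>k. (B * B') * (P k * x (t - 1 - int k)))"
    using assms unfolding good_past_def P_def by (intro exp_decay_cmult exp_decay_mult_subexp) auto
  then have "summable b" unfolding b_def by (rule exp_decay_summable)
  then have lim: "uniform_limit K (\<lambda>n th. \<Sum>k<n. egarch_back th x (Suc k) t - egarch_back th x k t)
      (\<lambda>th. \<Sum>k. egarch_back th x (Suc k) t - egarch_back th x k t) sequentially"
    using bound by (intro Weierstrass_m_test) auto
  have tel: "egarch_lo th + (\<Sum>k<n. egarch_back th x (Suc k) t - egarch_back th x k t) = egarch_back th x n t" for n th
    using sum_lessThan_telescope[of "\<lambda>k. egarch_back th x k t" n] by (simp del: egarch_back.simps(2))
  from lim have "uniform_limit K (\<lambda>n th. egarch_lo th + (\<Sum>k<n. egarch_back th x (Suc k) t - egarch_back th x k t))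
      (\<lambda>th. egarch_lo th + (\<Sum>k. egarch_back th x (Suc k) t - egarch_back th x k t)) sequentially"
    by (intro uniform_limit_intros)
  then have *: "uniform_limit K (\<lambda>n th. egarch_back th x n t)
      (\<lambda>th. egarch_lo th + (\<Sum>k. egarch_back th x (Suc k) t - egarch_back th x k t)) sequentially"
    unfolding tel .
  have "egarch_lo th + (\<Sum>k. egarch_back th x (Suc k) t - egarch_back th x k t) = egarch_h th x t" if "th \<in> K" for th
    using tendsto_uniform_limitI[OF * that] by (simp add: egarch_h_def limI)
  then show ?thesis using * by (simp cong: uniform_limit_cong')
qed

lemma back_tendsto: "good_past x t \<Longrightarrow> th \<in> K \<Longrightarrow> (\<lambda>k. egarch_back th x k t) \<longlonglongrightarrow> egarch_h th x t"
  using tendsto_uniform_limitI[OF back_uniform_limit] by blast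

lemma continuous_back: "continuous_on K (\<lambda>th. egarch_back th x k t)"
  by (induction k arbitrary: t) (auto simp: egarch_step_def news_def intro!: continuous_intros)

lemma continuous_h: "good_past x t \<Longrightarrow> continuous_on K (\<lambda>th. egarch_h th x t)"
  by (rule uniform_limit_theorem[OF always_eventually back_uniform_limit])
    (simp_all add: continuous_back)

lemma h_ge_lo: "good_past x t \<Longrightarrow> th \<in> K \<Longrightarrow> egarch_lo th \<le> egarch_h th x t"
  using back_tendsto[of x t th] back_ge_lo[of th x] by (intro LIMSEQ_le_const) auto

lemma h_rec:
  assumes "good_past x t" "th \<in> K"
  shows "egarch_h th x (t + 1) = egarch_step th (x t) (egarch_h th x t)"
proof -
  have "(\<lambda>k. egarch_back th x (Suc k) (t + 1)) \<longlonglongrightarrow> egarch_step th (x t) (egarch_h th x t)"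
    using back_tendsto[OF assms] unfolding egarch_step_def by (auto simp: egarch_step_def intro!: tendsto_intros)
  then have "(\<lambda>k. egarch_back th x k (t + 1)) \<longlonglongrightarrow> egarch_step th (x t) (egarch_h th x t)"
    by (rule LIMSEQ_imp_Suc)
  then show ?thesis unfolding egarch_h_def by (rule limI)
qed

text \<open>Backward subexponential growth of \<open>y\<close> is beaten by the decaying products,
  so the backward iterates converge to \<open>y t\<close> as well. This identifies the stationary
  solution at the true parameter with the true log-volatility.\<close>

lemma h_unique:
  assumes th: "th \<in> K" and rec: "\<And>t. y (t + 1) = egarch_step th (x t) (y t)" and ge: "\<And>t. y t \<ge> egarch_lo th"
    and gp: "good_past x t" and y: "subexp (\<lambda>k. y (t - int k))"
  shows "egarch_h th x t = y t"
proof -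
  have "exp_decay (\<lambda>k. (\<Prod>i<k. Lam (x (t - 1 - int i))) * (y (t - int k) + (- egarch_lo th)))"
    using gp y by (intro exp_decay_mult_subexp subexp_add subexp_const) (auto simp: good_past_def)
  then have "exp_decay (\<lambda>k. y t - egarch_back th x k t)"
  proof (rule exp_decay_mono)
    fix k
    show "\<bar>y t - egarch_back th x k t\<bar> \<le> \<bar>(\<Prod>i<k. Lam (x (t - 1 - int i))) * (y (t - int k) + (- egarch_lo th))\<bar>"
      using back_solution_diff[of th y x t k, OF th rec ge]
      by (simp add: abs_mult prod_nonneg Lam_nonneg)
  qed
  then have "(\<lambda>k. y t - egarch_back th x k t) \<longlonglongrightarrow> 0" by (rule exp_decay_tendsto_0)
  moreover have "(\<lambda>k. y t - egarch_back th x k t) \<longlonglongrightarrow> y t - egarch_h th x t"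
    by (intro tendsto_diff tendsto_const back_tendsto gp th)
  ultimately have "y t - egarch_h th x t = 0" using LIMSEQ_unique by blast
  then show ?thesis by simp
qed

section \<open>Forgetting an arbitrary initial value\<close>

lemma logh_Suc: "egarch_logh s th x (Suc t) = egarch_step th (x t) (egarch_logh s th x t)"
  by (simp add: egarch_step_def news_def)

text \<open>The news only pushes upwards, so a deficit below \<open>egarch_lo th\<close> shrinks at
  least by the factor \<open>par_beta th\<close> in each step.\<close>

lemma logh_ge:
  assumes th: "th \<in> K" and D: "\<bar>ln (s\<^sup>2) - egarch_lo th\<bar> \<le> D" and b: "par_beta th \<le> b"
  shows "egarch_logh s th x t \<ge> egarch_m K - b ^ t * D"
proof -
  have "egarch_logh s th x t - egarch_lo th \<ge> - (par_beta th ^ t * D)"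
  proof (induction t)
    case (Suc t)
    have "egarch_lo th = par_alpha th + par_beta th * egarch_lo th"
      using K_D(2)[OF th] by (simp add: egarch_lo_def field_simps)
    then have "egarch_logh s th x (Suc t) - egarch_lo th
        = par_beta th * (egarch_logh s th x t - egarch_lo th) + news th (x t) * exp (- egarch_logh s th x t / 2)"
      unfolding logh_Suc egarch_step_def by (simp add: algebra_simps)
    moreover have "0 \<le> news th (x t) * exp (- egarch_logh s th x t / 2)" using news_nonneg[OF th] by simp
    moreover have "par_beta th * (- (par_beta th ^ t * D)) \<le> par_beta th * (egarch_logh s th x t - egarch_lo th)"
      using Suc K_D(1)[OF th] by (intro mult_left_mono)
    ultimately show ?case by simp
  qed (use D in auto)
  moreover have "par_beta th ^ t * D \<le> b ^ t * D"
    using D b K_D(1)[OF th] by (intro mult_right_mono power_mono) auto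
  ultimately show ?thesis using m_le_lo[OF th] by linarith
qed

text \<open>\<open>step_lipschitz\<close> is applied at time \<open>t\<close> with slack
  \<open>b ^ t * D\<close>, the deficit allowed by \<open>logh_ge\<close>; the slack factors
  multiply up to the exponential of a partial geometric sum.\<close>

lemma logh_forward_diff:
  assumes th: "th \<in> K" and D: "\<bar>ln (s\<^sup>2) - egarch_lo th\<bar> \<le> D" and b: "par_beta th \<le> b"
    and rec: "\<And>t. y (Suc t) = egarch_step th (x t) (y t)" and ge: "\<And>t. y t \<ge> egarch_lo th"
  shows "\<bar>egarch_logh s th x n - y n\<bar> \<le> exp (\<Sum>t<n. b ^ t * D) * (\<Prod>t<n. Lam (x t)) * \<bar>ln (s\<^sup>2) - y 0\<bar>"
proof (induction n)
  case (Suc n)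
  have D0: "D \<ge> 0" using D by linarith
  have b0: "b \<ge> 0" using b K_D(1)[OF th] by linarith
  have "\<bar>egarch_logh s th x (Suc n) - y (Suc n)\<bar> \<le> exp (b ^ n * D) * Lam (x n) * \<bar>egarch_logh s th x n - y n\<bar>"
    unfolding logh_Suc rec
  proof (rule step_lipschitz[OF th])
    show "0 \<le> b ^ n * D" using D0 b0 by simp
    then show "y n \<ge> egarch_m K - b ^ n * D" using ge[of n] m_le_lo[OF th] by linarith
  qed (rule logh_ge[OF th D b])
  also have "\<dots> \<le> exp (b ^ n * D) * Lam (x n) * (exp (\<Sum>t<n. b ^ t * D) * (\<Prod>t<n. Lam (x t)) * \<bar>ln (s\<^sup>2) - y 0\<bar>)"
    using Lam_nonneg by (intro mult_left_mono Suc) auto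
  finally show ?case by (simp add: exp_add algebra_simps)
qed simp

lemma loss_diff:
  assumes "v \<ge> a" "v' \<ge> a"
  shows "\<bar>egarch_loss x v - egarch_loss x v'\<bar> \<le> (x\<^sup>2 * exp (- a) + 1) * \<bar>v - v'\<bar>"
proof -
  have main: "\<bar>egarch_loss x v - egarch_loss x v'\<bar> \<le> (x\<^sup>2 * exp (- a) + 1) * \<bar>v - v'\<bar>"
    if "v' \<le> v" "v' \<ge> a" for v v'
  proof -
    have "exp (- v') - exp (- v) \<le> exp (- v') * (v - v')" using exp_neg_diff_le[of 1 v' v] that by simp
    also have "\<dots> \<le> exp (- a) * (v - v')" using that by (intro mult_right_mono) auto
    finally have "x\<^sup>2 * (exp (- v') - exp (- v)) \<le> x\<^sup>2 * (exp (- a) * (v - v'))" by (rule mult_left_mono) simp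
    moreover have "0 \<le> x\<^sup>2 * (exp (- v') - exp (- v))" using that by simp
    moreover have "egarch_loss x v - egarch_loss x v' = (v - v') - x\<^sup>2 * (exp (- v') - exp (- v))"
      by (simp add: egarch_loss_def exp_minus field_simps)
    moreover have "(x\<^sup>2 * exp (- a) + 1) * \<bar>v - v'\<bar> = x\<^sup>2 * (exp (- a) * (v - v')) + (v - v')"
      using that by (simp add: algebra_simps)
    ultimately show ?thesis using that by linarith
  qed
  show ?thesis
  proof (cases "v' \<le> v")
    case True then show ?thesis using main assms by blast
  next
    case False then show ?thesis using main[of v v'] assms by (simp add: abs_minus_commute)
  qed
qed

text \<open>Each difference is a decaying product times a subexponential factor quadratic in the
  observation, hence summable. Starting from the wrong value therefore costs a total that is bounded
  in \<open>n\<close> and uniform over \<open>K\<close>.\<close>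

lemma loss_sum_diff:
  assumes gp: "\<And>t. good_past x t"
    and dec: "exp_decay (\<lambda>n. \<Prod>i<n. Lam (x (int i)))" and sub: "subexp (\<lambda>n. x (int n))"
  shows "\<exists>C. \<forall>th\<in>K. \<forall>n. (\<Sum>t=1..n. \<bar>egarch_loss (x (int t)) (egarch_logh s th (\<lambda>t. x (int t)) t)
      - egarch_loss (x (int t)) (egarch_h th x (int t))\<bar>) \<le> C"
proof -
  have "continuous_on K (\<lambda>th. ln (s\<^sup>2) - egarch_lo th)" by (intro continuous_intros)
  then obtain D where D: "D \<ge> 0" "\<And>th. th \<in> K \<Longrightarrow> \<bar>ln (s\<^sup>2) - egarch_lo th\<bar> \<le> D"
    using continuous_K_bounded by blast
  have "continuous_on K (\<lambda>th. ln (s\<^sup>2) - egarch_h th x 0)" by (intro continuous_intros continuous_h gp)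
  then obtain H where H: "H \<ge> 0" "\<And>th. th \<in> K \<Longrightarrow> \<bar>ln (s\<^sup>2) - egarch_h th x 0\<bar> \<le> H"
    using continuous_K_bounded by blast
  obtain b where b: "0 \<le> b" "b < 1" "\<And>th. th \<in> K \<Longrightarrow> par_beta th \<le> b" using beta_bound by blast
  \<comment> \<open>A common lower bound for both volatility paths, where the loss is Lipschitz with
    factor \<open>x\<^sup>2 * exp (- a) + 1\<close>.\<close>
  define a where "a = egarch_m K - D"
  define P where "P n = (\<Prod>i<n. Lam (x (int i)))" for n
  \<comment> \<open>All slack factors together, bounded by the full geometric series, times the
    largest initial discrepancy.\<close>
  define c where "c = exp (D / (1 - b)) * H"
  define u where "u n = P n * (c * (x (int n) * x (int n) * exp (- a) + 1))" for n
  have P0: "P n \<ge> 0" for n unfolding P_def by (intro prod_nonneg) (simp add: Lam_nonneg)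
  have c0: "c \<ge> 0" using H by (simp add: c_def)
  have u0: "u n \<ge> 0" for n unfolding u_def using P0 c0 by (intro mult_nonneg_nonneg) auto
  have "exp_decay u"
    unfolding u_def[abs_def] P_def
    by (rule exp_decay_mult_subexp[OF dec subexp_mult[OF subexp_const
          subexp_add[OF subexp_mult[OF subexp_mult[OF sub sub] subexp_const] subexp_const]]])
  then have su: "summable u" using exp_decay_summable[of u] u0 by simp
  have bound: "\<bar>egarch_loss (x (int t)) (egarch_logh s th (\<lambda>t. x (int t)) t)
      - egarch_loss (x (int t)) (egarch_h th x (int t))\<bar> \<le> u t" if th: "th \<in> K" for th t
  proof -
    let ?v = "egarch_logh s th (\<lambda>t. x (int t)) t" and ?v' = "egarch_h th x (int t)"
    have "\<bar>?v - ?v'\<bar> \<le> exp (\<Sum>i<t. b ^ i * D) * (\<Prod>i<t. Lam (x (int i))) * \<bar>ln (s\<^sup>2) - egarch_h th x (int 0)\<bar>"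
    proof (rule logh_forward_diff[OF th D(2)[OF th] b(3)[OF th]])
      show "egarch_h th x (int (Suc i)) = egarch_step th (x (int i)) (egarch_h th x (int i))" for i
        using h_rec[OF gp th, of "int i"] by (simp add: add.commute)
    qed (rule h_ge_lo[OF gp th])
    also have "\<dots> \<le> exp (D / (1 - b)) * P t * H"
    proof (intro mult_mono)
      have "(\<Sum>i<t. b ^ i) \<le> (\<Sum>i. b ^ i)" using b by (intro sum_le_suminf summable_geometric) auto
      also have "\<dots> = 1 / (1 - b)" using b by (intro suminf_geometric) auto
      finally have "(\<Sum>i<t. b ^ i) * D \<le> 1 / (1 - b) * D" using D by (intro mult_right_mono)
      then show "exp (\<Sum>i<t. b ^ i * D) \<le> exp (D / (1 - b))" by (simp add: sum_distrib_right)
      show "(\<Prod>i<t. Lam (x (int i))) \<le> P t" "0 \<le> (\<Prod>i<t. Lam (x (int i)))"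
        using P0[of t] by (simp_all only: P_def order_refl)
      show "\<bar>ln (s\<^sup>2) - egarch_h th x (int 0)\<bar> \<le> H" using H(2)[OF th] by simp
    qed (use P0[of t] in \<open>simp_all\<close>)
    also have "\<dots> = P t * c" by (simp add: c_def)
    finally have d: "\<bar>?v - ?v'\<bar> \<le> P t * c" .
    have "b ^ t * D \<le> 1 * D" using b D by (intro mult_right_mono power_le_one) auto
    then have "?v \<ge> a" using logh_ge[OF th D(2)[OF th] b(3)[OF th], of t "\<lambda>t. x (int t)"] by (simp add: a_def)
    moreover have "?v' \<ge> a" using h_ge_lo[OF gp th, of "int t"] m_le_lo[OF th] D(1) by (simp add: a_def)
    ultimately have "\<bar>egarch_loss (x (int t)) ?v - egarch_loss (x (int t)) ?v'\<bar> \<le> ((x (int t))\<^sup>2 * exp (- a) + 1) * \<bar>?v - ?v'\<bar>"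
      by (rule loss_diff)
    also have "\<dots> \<le> ((x (int t))\<^sup>2 * exp (- a) + 1) * (P t * c)" by (intro mult_left_mono d) auto
    also have "\<dots> = u t" by (simp add: u_def power2_eq_square algebra_simps)
    finally show ?thesis .
  qed
  show ?thesis
  proof (intro exI ballI allI)
    fix th n assume th: "th \<in> K"
    have "(\<Sum>t=1..n. \<bar>egarch_loss (x (int t)) (egarch_logh s th (\<lambda>t. x (int t)) t)
      - egarch_loss (x (int t)) (egarch_h th x (int t))\<bar>) \<le> (\<Sum>t=1..n. u t)"
      by (intro sum_mono bound th)
    also have "\<dots> \<le> suminf u" using u0 by (intro sum_le_suminf su) auto
    finally show "(\<Sum>t=1..n. \<bar>egarch_loss (x (int t)) (egarch_logh s th (\<lambda>t. x (int t)) t)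
      - egarch_loss (x (int t)) (egarch_h th x (int t))\<bar>) \<le> suminf u" .
  qed
qed

end

section \<open>Stationary solutions on the path space\<close>

lemma sublinear_imp_subexp:
  assumes "\<And>\<epsilon>::real. \<epsilon> > 0 \<Longrightarrow> \<exists>C. \<forall>n. \<bar>u n\<bar> \<le> C + \<epsilon> * real n"
  shows "subexp u"
  unfolding subexp_def
proof (intro allI impI)
  fix \<epsilon> :: real assume \<epsilon>: "\<epsilon> > 0"
  obtain C where C: "\<forall>n. \<bar>u n\<bar> \<le> C + \<epsilon> * real n" using assms[OF \<epsilon>] by (rule exE)
  have "\<bar>u n\<bar> \<le> (\<bar>C\<bar> + 1) * exp (\<epsilon> * real n)" for n
  proof -
    have "\<bar>C\<bar> * 1 \<le> \<bar>C\<bar> * exp (\<epsilon> * real n)" using \<epsilon> by (intro mult_left_mono) auto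
    moreover have "\<epsilon> * real n \<le> exp (\<epsilon> * real n)" using exp_ge_add_one_self[of "\<epsilon> * real n"] by linarith
    moreover have "\<bar>u n\<bar> \<le> C + \<epsilon> * real n" using C by blast
    ultimately show ?thesis unfolding distrib_right by linarith
  qed
  then show "\<exists>C. \<forall>n. \<bar>u n\<bar> \<le> C * exp (\<epsilon> * real n)" by blast
qed

text \<open>The observation scale is the exponential of half the log-volatility, so the latter has
  to grow sublinearly; subexponential growth would be too weak.\<close>

lemma sublinear_imp_subexp_exp:
  assumes "\<And>\<epsilon>::real. \<epsilon> > 0 \<Longrightarrow> \<exists>C. \<forall>n. \<bar>u n\<bar> \<le> C + \<epsilon> * real n"
  shows "subexp (\<lambda>n. exp (u n / 2))"
  unfolding subexp_def
proof (intro allI impI)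
  fix \<epsilon> :: real assume \<epsilon>: "\<epsilon> > 0"
  obtain C where C: "\<forall>n. \<bar>u n\<bar> \<le> C + \<epsilon> * real n" using assms[OF \<epsilon>] by (rule exE)
  have "\<bar>exp (u n / 2)\<bar> \<le> exp (\<bar>C\<bar>) * exp (\<epsilon> * real n)" for n
  proof -
    have "\<bar>u n\<bar> \<le> C + \<epsilon> * real n" using C by blast
    moreover have "\<epsilon> * real n \<ge> 0" using \<epsilon> by simp
    ultimately have "u n / 2 \<le> \<bar>C\<bar> + \<epsilon> * real n" by linarith
    then show ?thesis by (simp add: exp_add[symmetric])
  qed
  then show "\<exists>C. \<forall>n. \<bar>exp (u n / 2)\<bar> \<le> C * exp (\<epsilon> * real n)" by blast
qed

lemma exp_decay_power:
  assumes "0 \<le> b" "b < 1" shows "exp_decay (\<lambda>n. b ^ n)"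
proof -
  \<comment> \<open>The rate is \<open>- ln c\<close>, which needs a positive base, whereas
    \<open>b = 0\<close> is allowed.\<close>
  define c where "c = max b (1/2)"
  have c: "0 < c" "c < 1" "b \<le> c" using assms by (auto simp: c_def)
  have "\<bar>b ^ n\<bar> \<le> 1 * exp (- (- ln c) * real n)" for n
  proof -
    have "b ^ n \<le> c ^ n" using assms c by (intro power_mono)
    also have "c ^ n = exp (ln c) ^ n" using c by simp
    also have "\<dots> = exp (- (- ln c) * real n)" by (simp add: exp_of_nat_mult[symmetric] mult.commute)
    finally show ?thesis using assms by simp
  qed
  moreover have "- ln c > 0" using c by simp
  ultimately show ?thesis unfolding exp_decay_def by blast
qed

section \<open>Growth along almost every path\<close>

context iid_path
begin

text \<open>The excess of \<open>\<bar>f\<bar>\<close> over a large level \<open>N\<close> has mean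
  below \<open>\<epsilon>\<close>, so its sums minus \<open>\<epsilon>\<close> per step are bounded
  above by the ergodic theorem.\<close>

lemma AE_sublinear:
  fixes f :: "(int \<Rightarrow> 'b) \<Rightarrow> real"
  assumes s: "s \<noteq> 0" and f: "integrable W f"
  shows "AE w in W. \<forall>\<epsilon>>0. \<exists>C. \<forall>n. \<bar>f (tshift (s * int n) w)\<bar> \<le> C + \<epsilon> * real n"
proof -
  have *: "AE w in W. \<exists>C. \<forall>n. \<bar>f (tshift (s * int n) w)\<bar> \<le> C + \<epsilon> * real n" if \<epsilon>: "\<epsilon> > 0" for \<epsilon> :: real
  proof -
    have fm: "f \<in> borel_measurable W" using f by simp
    have i: "integrable W (\<lambda>w. max 0 (\<bar>f w\<bar> - real N))" for N
      using f by (intro integrable_max Bochner_Integration.integrable_diff integrable_abs) auto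
    have "(\<lambda>N. \<integral>w. max 0 (\<bar>f w\<bar> - real N) \<partial>W) \<longlonglongrightarrow> (\<integral>w. 0 \<partial>W)"
    proof (rule integral_dominated_convergence[where w="\<lambda>w. \<bar>f w\<bar>"])
      show "AE w in W. (\<lambda>N. max 0 (\<bar>f w\<bar> - real N)) \<longlonglongrightarrow> 0"
      proof (rule AE_I2)
        fix w
        obtain N0 :: nat where "\<bar>f w\<bar> \<le> real N0" using real_arch_simple by blast
        then have "max 0 (\<bar>f w\<bar> - real N) = 0" if "N \<ge> N0" for N using that by auto
        then show "(\<lambda>N. max 0 (\<bar>f w\<bar> - real N)) \<longlonglongrightarrow> 0"
          by (intro tendsto_eventually eventually_sequentiallyI[of N0]) blast
      qed
      show "(\<lambda>w. max 0 (\<bar>f w\<bar> - real N)) \<in> borel_measurable W" for N using i[of N] by simp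
    qed (use f in auto)
    then have "eventually (\<lambda>N. (\<integral>w. max 0 (\<bar>f w\<bar> - real N) \<partial>W) < \<epsilon> / 2) sequentially"
      using \<epsilon> by (intro order_tendstoD(2)) auto
    then obtain N where N: "(\<integral>w. max 0 (\<bar>f w\<bar> - real N) \<partial>W) < \<epsilon> / 2"
      unfolding eventually_sequentially by blast
    have "AE w in W. \<exists>C. \<forall>n. (\<Sum>t<n. max 0 (\<bar>f (tshift (s * int t) w)\<bar> - real N) - \<epsilon>) \<le> C"
    proof (rule shift_sums_bounded[OF s])
      show "integrable W (\<lambda>w. max 0 (\<bar>f w\<bar> - real N) - \<epsilon>)" using i by auto
      show "(\<integral>w. max 0 (\<bar>f w\<bar> - real N) - \<epsilon> \<partial>W) < 0"
        using N \<epsilon> i by (simp add: W.prob_space)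
    qed
    then show ?thesis
    proof (rule AE_mp, intro AE_I2 impI)
      fix w assume "\<exists>C. \<forall>n. (\<Sum>t<n. max 0 (\<bar>f (tshift (s * int t) w)\<bar> - real N) - \<epsilon>) \<le> C"
      then obtain C where C: "\<And>n. (\<Sum>t<n. max 0 (\<bar>f (tshift (s * int t) w)\<bar> - real N) - \<epsilon>) \<le> C" by blast
      have "\<bar>f (tshift (s * int n) w)\<bar> \<le> (C + \<epsilon> + real N) + \<epsilon> * real n" for n
      proof -
        have "\<bar>f (tshift (s * int n) w)\<bar> - real N \<le> max 0 (\<bar>f (tshift (s * int n) w)\<bar> - real N)" by simp
        \<comment> \<open>A single term is at most the sum, since all terms are nonnegative.\<close>
        also have "\<dots> \<le> (\<Sum>t<Suc n. max 0 (\<bar>f (tshift (s * int t) w)\<bar> - real N))"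
          by (rule member_le_sum) auto
        also have "\<dots> \<le> C + \<epsilon> * real (Suc n)"
          using C[of "Suc n"] by (simp add: sum_subtractf algebra_simps)
        finally show ?thesis by (simp add: algebra_simps)
      qed
      then show "\<exists>C. \<forall>n. \<bar>f (tshift (s * int n) w)\<bar> \<le> C + \<epsilon> * real n" by blast
    qed
  qed
  \<comment> \<open>The null set depends on \<open>\<epsilon>\<close>, so the rates are first
    restricted to a countable family tending to 0.\<close>
  have "AE w in W. \<forall>m. \<exists>C. \<forall>n. \<bar>f (tshift (s * int n) w)\<bar> \<le> C + inverse (real (Suc m)) * real n"
    unfolding AE_all_countable using * by simp
  then show ?thesis
  proof (rule AE_mp, intro AE_I2 impI allI)
    fix w and \<epsilon> :: real
    assume a: "\<forall>m. \<exists>C. \<forall>n. \<bar>f (tshift (s * int n) w)\<bar> \<le> C + inverse (real (Suc m)) * real n" and "\<epsilon> > 0"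
    then obtain m where m: "inverse (real (Suc m)) < \<epsilon>" using reals_Archimedean by blast
    obtain C where "\<forall>n. \<bar>f (tshift (s * int n) w)\<bar> \<le> C + inverse (real (Suc m)) * real n" using a by blast
    moreover have "inverse (real (Suc m)) * real n \<le> \<epsilon> * real n" for n using m by (intro mult_right_mono) auto
    ultimately have "\<forall>n. \<bar>f (tshift (s * int n) w)\<bar> \<le> C + \<epsilon> * real n" by (meson add_left_mono order_trans)
    then show "\<exists>C. \<forall>n. \<bar>f (tshift (s * int n) w)\<bar> \<le> C + \<epsilon> * real n" by blast
  qed
qed

lemma AE_subexp:
  fixes f :: "(int \<Rightarrow> 'b) \<Rightarrow> real"
  assumes "s \<noteq> 0" "integrable W f"
  shows "AE w in W. subexp (\<lambda>n. f (tshift (s * int n) w))"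
  using AE_sublinear[OF assms]
  by (rule AE_mp) (intro AE_I2 impI sublinear_imp_subexp, blast)

lemma distr_coord: "distr W D (\<lambda>w. w i) = D"
  unfolding W_def by (rule P.PiM_component) simp

lemma integrable_coord:
  fixes f :: "'b \<Rightarrow> real"
  assumes "integrable D f" shows "integrable W (\<lambda>w. f (w i))"
  using integrable_distr[OF measurable_coord, of i f] assms by (simp add: distr_coord)

lemma integral_coord:
  fixes f :: "'b \<Rightarrow> real"
  assumes "f \<in> borel_measurable D" shows "(\<integral>w. f (w i) \<partial>W) = integral\<^sup>L D f"
  using integral_distr[OF measurable_coord assms, of i] by (simp add: distr_coord)

end

lemma news_scale: "c \<ge> 0 \<Longrightarrow> news th (c * x) = c * news th x"
  by (simp add: news_def abs_mult algebra_simps)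

section \<open>The true process as a function of the innovations\<close>

locale egarch_model = iid_path D for D :: "real measure" +
  fixes th0 :: egarch_param
  assumes sets_D: "sets D = sets borel"
    and D_int: "integrable D (\<lambda>z. z)" and D_mean: "(\<integral>z. z \<partial>D) = 0"
    and D_int2: "integrable D (\<lambda>z. z\<^sup>2)" and D_var: "(\<integral>z. z\<^sup>2 \<partial>D) = 1"
    and D_not2: "\<And>a b. measure D {a, b} < 1"
    and th0_space: "th0 \<in> egarch_space"
    and th0_nontrivial: "(par_gamma th0, par_delta th0) \<noteq> (0, 0)"
begin

lemma th0_D: "0 \<le> par_beta th0" "par_beta th0 < 1" "\<bar>par_gamma th0\<bar> \<le> par_delta th0"
  using th0_space by (auto simp: egarch_space_def)

lemma news0_nonneg: "0 \<le> news th0 z"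
proof -
  have "\<bar>par_gamma th0 * z\<bar> \<le> par_delta th0 * \<bar>z\<bar>"
    unfolding abs_mult by (rule mult_right_mono[OF th0_D(3)]) simp
  then show ?thesis unfolding news_def by linarith
qed

text \<open>Being defined on every path, it commutes with the shift and ignores the present
  innovation everywhere; only the recursion requires a convergent series.\<close>

definition logvol :: "(int \<Rightarrow> real) \<Rightarrow> int \<Rightarrow> real" where
  "logvol w t = egarch_lo th0 + (\<Sum>k. par_beta th0 ^ k * news th0 (w (t - 1 - int k)))"

definition obs :: "(int \<Rightarrow> real) \<Rightarrow> int \<Rightarrow> real" where
  "obs w t = exp (logvol w t / 2) * w t"

lemma logvol_tshift: "logvol (tshift s w) t = logvol w (t + s)"
  by (simp add: logvol_def tshift_def algebra_simps)

lemma obs_tshift: "obs (tshift s w) t = obs w (t + s)"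
  by (simp add: obs_def logvol_tshift) (simp add: tshift_def)

lemma measurable_D_borel [measurable_cong]: "sets D = sets borel"
  by (rule sets_D)

lemma measurable_coord_real [measurable]: "(\<lambda>w. w i) \<in> borel_measurable W"
  using measurable_coord measurable_cong_sets[OF refl sets_D] by blast

lemma measurable_logvol [measurable]: "(\<lambda>w. logvol w t) \<in> borel_measurable W"
  unfolding logvol_def news_def by measurable

lemma measurable_obs [measurable]: "(\<lambda>w. obs w t) \<in> borel_measurable W"
  unfolding obs_def by measurable

lemma integrable_news: "integrable D (news th0)"
  unfolding news_def[abs_def] using D_int by auto

text \<open>The news along the past grows subexponentially almost surely and is beaten by the powers
  of \<open>par_beta th0\<close>.\<close>

lemma AE_summable: "AE w in W. \<forall>t. summable (\<lambda>k. par_beta th0 ^ k * news th0 (w (t - 1 - int k)))"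
proof -
  have "AE w in W. \<forall>t. subexp (\<lambda>n. news th0 (tshift (-1 * int n) (tshift t w) 0))"
    using AE_all_shift[OF AE_subexp[of "-1" "\<lambda>w. news th0 (w 0)"]] integrable_coord[OF integrable_news] by simp
  then show ?thesis
  proof (rule AE_mp, intro AE_I2 impI allI)
    fix w t assume a: "\<forall>t. subexp (\<lambda>n. news th0 (tshift (-1 * int n) (tshift t w) 0))"
    have "subexp (\<lambda>n. news th0 (w (t - 1 - int n)))"
      using a[rule_format, of "t - 1"] by (simp add: tshift_def algebra_simps)
    then have "exp_decay (\<lambda>n. par_beta th0 ^ n * news th0 (w (t - 1 - int n)))"
      by (rule exp_decay_mult_subexp[OF exp_decay_power[OF th0_D(1,2)]])
    then show "summable (\<lambda>n. par_beta th0 ^ n * news th0 (w (t - 1 - int n)))"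
      by (rule summable_rabs_cancel[OF exp_decay_summable])
  qed
qed

lemma integrable_logvol: "integrable W (\<lambda>w. logvol w t)"
proof -
  let ?f = "\<lambda>k w. par_beta th0 ^ k * news th0 (w (t - 1 - int k))"
  have nn: "\<bar>?f k w\<bar> = ?f k w" for k w using th0_D(1) news0_nonneg by simp
  have "integrable W (\<lambda>w. \<Sum>k. ?f k w)"
  proof (rule integrable_suminf)
    show "integrable W (?f k)" for k
      by (intro integrable_mult_right integrable_coord integrable_news)
    show "AE w in W. summable (\<lambda>k. norm (?f k w))"
      unfolding real_norm_def nn using AE_summable by (rule AE_mp) (intro AE_I2 impI, erule spec)
    have "(\<integral>w. norm (?f k w) \<partial>W) = par_beta th0 ^ k * integral\<^sup>L D (news th0)" for k
      unfolding real_norm_def nn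
      using integral_coord[of "news th0" "t - 1 - int k"] integrable_news by simp
    then show "summable (\<lambda>k. \<integral>w. norm (?f k w) \<partial>W)"
      using th0_D by (simp add: summable_mult2 summable_geometric)
  qed
  then show ?thesis unfolding logvol_def by simp
qed

lemma lo0_eq: "egarch_lo th0 = par_alpha th0 + par_beta th0 * egarch_lo th0"
  using th0_D(2) by (simp add: egarch_lo_def field_simps)

text \<open>The scale of the observation cancels the damping factor of the step. This holds for
  every \<open>th\<close>, so the recursions of two parameters can be compared on the same
  innovations.\<close>

lemma step_obs: "egarch_step th (obs w t) (logvol w t) = par_alpha th + par_beta th * logvol w t + news th (w t)"
proof -
  have "news th (obs w t) * exp (- logvol w t / 2) = news th (w t) * (exp (logvol w t / 2) * exp (- logvol w t / 2))"
    by (simp add: obs_def news_scale)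
  also have "exp (logvol w t / 2) * exp (- logvol w t / 2) = 1" by (simp add: exp_add[symmetric])
  finally show ?thesis by (simp add: egarch_step_def)
qed

lemma logvol_rec:
  assumes "\<And>t. summable (\<lambda>k. par_beta th0 ^ k * news th0 (w (t - 1 - int k)))"
  shows "logvol w (t + 1) = par_alpha th0 + par_beta th0 * logvol w t + news th0 (w t)"
proof -
  let ?f = "\<lambda>k. par_beta th0 ^ k * news th0 (w (t + 1 - 1 - int k))"
  let ?g = "\<lambda>k. par_beta th0 ^ k * news th0 (w (t - 1 - int k))"
  have "suminf ?f = ?f 0 + (\<Sum>k. ?f (Suc k))"
    using suminf_split_head[OF assms[of "t + 1"]] by simp
  also have "(\<lambda>k. ?f (Suc k)) = (\<lambda>k. par_beta th0 * ?g k)" by (simp add: fun_eq_iff algebra_simps)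
  also have "(\<Sum>k. par_beta th0 * ?g k) = par_beta th0 * suminf ?g" by (rule suminf_mult[OF assms])
  finally have "suminf ?f = news th0 (w t) + par_beta th0 * suminf ?g" by simp
  then have "logvol w (t + 1) = egarch_lo th0 + (news th0 (w t) + par_beta th0 * suminf ?g)"
    unfolding logvol_def by simp
  also have "\<dots> = par_alpha th0 + par_beta th0 * logvol w t + news th0 (w t)"
    unfolding logvol_def by (subst lo0_eq) (simp add: algebra_simps)
  finally show ?thesis .
qed

lemma logvol_ge:
  assumes "\<And>t. summable (\<lambda>k. par_beta th0 ^ k * news th0 (w (t - 1 - int k)))"
  shows "logvol w t \<ge> egarch_lo th0"
  unfolding logvol_def using suminf_nonneg[OF assms[of t]] th0_D(1) news0_nonneg by simp

text \<open>An observation is \<open>exp (logvol w t / 2)\<close> times an innovation: the first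
  factor is subexponential by sublinear growth of \<open>logvol\<close>, the second by
  integrability.\<close>

lemma subexp_obs:
  assumes s: "s \<noteq> 0"
  shows "AE w in W. \<forall>t. subexp (\<lambda>n. obs w (t + s * int n)) \<and> subexp (\<lambda>n. logvol w (t + s * int n))"
proof -
  have "AE w in W. subexp (\<lambda>n. obs w (s * int n)) \<and> subexp (\<lambda>n. logvol w (s * int n))"
    using AE_sublinear[OF s integrable_logvol[of 0]] AE_subexp[OF s integrable_coord[OF D_int, of 0]]
  proof eventually_elim
    case (elim w)
    have e: "logvol (tshift (s * int n) w) 0 = logvol w (s * int n)" for n by (simp add: logvol_tshift)
    have sl: "\<exists>C. \<forall>n. \<bar>logvol w (s * int n)\<bar> \<le> C + \<epsilon> * real n" if "\<epsilon> > 0" for \<epsilon>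
      using elim(1) that unfolding e by blast
    have "subexp (\<lambda>n. exp (logvol w (s * int n) / 2) * w (s * int n))"
      using elim(2) by (intro subexp_mult sublinear_imp_subexp_exp sl) (simp_all add: tshift_def)
    then show ?case using sublinear_imp_subexp[OF sl] by (simp add: obs_def)
  qed
  from AE_all_shift[OF this] show ?thesis
    by (rule AE_mp) (intro AE_I2 impI, simp add: obs_tshift logvol_tshift add.commute)
qed

end

section \<open>Contraction along almost every path\<close>

locale egarch_qmle = egarch_model D th0 + egarch_compact K for D th0 K +
  assumes th0_K: "th0 \<in> K"
    and Klog: "log_mean_neg W (\<lambda>w. Lam (obs w 0))"
begin

lemma measurable_Lam [measurable]: "Lam \<in> borel_measurable borel"
  using continuous_Lam by (rule borel_measurable_continuous_onI)

text \<open>\<open>Lam\<close> may vanish or have a logarithm of mean minus infinity. The truncated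
  negative parts increase to the full one, so by monotone convergence some truncation already
  outweighs the positive part, and it is integrable.\<close>

lemma truncated_log_Lam:
  obtains \<eta> where "0 < \<eta>" "integrable W (\<lambda>w. ln (max \<eta> (Lam (obs w 0))))"
    "(\<integral>w. ln (max \<eta> (Lam (obs w 0))) \<partial>W) < 0"
proof -
  define f where "f w = Lam (obs w 0)" for w
  have [measurable]: "f \<in> borel_measurable W" unfolding f_def by measurable
  have f0: "f w \<ge> 0" for w by (simp add: f_def Lam_nonneg)
  define e where "e n = inverse (real (Suc n))" for n
  have e: "0 < e n" "e n \<le> 1" for n unfolding e_def by (auto simp: field_simps)
  have e_anti: "e n \<le> e m" if "m \<le> n" for m n unfolding e_def using that by (auto simp: field_simps)
  define N where "N n w = ennreal (max 0 (- ln (max (e n) (f w))))" for n w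
  define I where "I = (\<integral>\<^sup>+ w. ennreal (max 0 (ln (f w))) \<partial>W)"
  have inc: "incseq N"
  proof (rule incseq_SucI, rule le_funI)
    fix n w
    have "ln (max (e (Suc n)) (f w)) \<le> ln (max (e n) (f w))"
      using e(1)[of "Suc n"] e_anti[of n "Suc n"] by (subst ln_le_cancel_iff) auto
    then show "N n w \<le> N (Suc n) w" unfolding N_def by (intro ennreal_leI) auto
  qed
  have sup: "(SUP n. N n w) = (if f w \<le> 0 then \<infinity> else ennreal (max 0 (- ln (f w))))" for w
  proof (cases "f w \<le> 0")
    case True
    then have "f w = 0" using f0[of w] by simp
    \<comment> \<open>At a zero of \<open>f\<close> the truncated negative parts are unbounded in
      \<open>n\<close>, which matches the value infinity prescribed in
      \<open>log_mean_neg\<close>.\<close>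
    have "N n w = ennreal (ln (real (Suc n)))" for n
    proof -
      have "max (e n) (f w) = e n" using e[of n] \<open>f w = 0\<close> by simp
      moreover have "- ln (e n) = ln (real (Suc n))" unfolding e_def by (simp add: ln_inverse)
      moreover have "0 \<le> ln (real (Suc n))" by simp
      ultimately show ?thesis unfolding N_def by simp
    qed
    moreover have "(SUP n. ennreal (ln (real (Suc n)))) = \<top>"
    proof (rule ennreal_SUP_eq_top)
      fix m :: nat
      obtain k where "exp (real m) \<le> real k" using real_arch_simple by blast
      then have "exp (real m) \<le> real (Suc k)" by simp
      then have "real m \<le> ln (real (Suc k))" using ln_ge_iff[of "real (Suc k)" "real m"] by simp
      then have "of_nat m \<le> ennreal (ln (real (Suc k)))"
        using ennreal_leI[of "real m"] by (simp add: ennreal_of_nat_eq_real_of_nat)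
      then show "\<exists>i\<in>UNIV. of_nat m \<le> ennreal (ln (real (Suc i)))" by blast
    qed
    ultimately show ?thesis using True by simp
  next
    case False
    have le: "N n w \<le> ennreal (max 0 (- ln (f w)))" for n
    proof -
      have "ln (f w) \<le> ln (max (e n) (f w))" using False by (subst ln_le_cancel_iff) auto
      then show ?thesis unfolding N_def by (intro ennreal_leI) auto
    qed
    obtain n where n: "e n < f w" using False reals_Archimedean[of "f w"] unfolding e_def by auto
    then have "N n w = ennreal (max 0 (- ln (f w)))" by (simp add: N_def max_def)
    then have "(SUP n. N n w) = ennreal (max 0 (- ln (f w)))"
      using le by (intro antisym SUP_least SUP_upper2[of n]) auto
    then show ?thesis using False by simp
  qed
  have [measurable]: "N n \<in> borel_measurable W" for n unfolding N_def by measurable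
  have "I < (\<integral>\<^sup>+ w. (SUP n. N n w) \<partial>W)"
    using Klog unfolding log_mean_neg_def sup I_def f_def .
  also have "\<dots> = (SUP n. \<integral>\<^sup>+ w. N n w \<partial>W)"
    using inc by (intro nn_integral_monotone_convergence_SUP) auto
  finally obtain n where n: "I < (\<integral>\<^sup>+ w. N n w \<partial>W)" unfolding less_SUP_iff by blast
  \<comment> \<open>As \<open>e n \<le> 1\<close>, truncation leaves the positive part of the
    logarithm alone.\<close>
  have split: "ln (max (e n) (f w)) = max 0 (ln (f w)) - max 0 (- ln (max (e n) (f w)))" for w
  proof (cases "f w \<ge> 1")
    case True
    then have "max (e n) (f w) = f w" using e[of n] by simp
    moreover have "ln (f w) \<ge> 0" using True by simp
    ultimately show ?thesis by simp
  next
    case False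
    \<comment> \<open>The case \<open>f w = 0\<close> relies on the convention
      \<open>ln 0 = 0\<close>.\<close>
    have "ln (f w) \<le> 0" using False f0[of w] by (cases "f w = 0") auto
    moreover have "ln (max (e n) (f w)) \<le> 0" using False e[of n] by (subst ln_le_zero_iff) auto
    ultimately show ?thesis by simp
  qed
  then have eqf: "(\<lambda>w. ln (max (e n) (f w))) = (\<lambda>w. max 0 (ln (f w)) - max 0 (- ln (max (e n) (f w))))"
    by (intro ext)
  have Nle: "N n w \<le> ennreal (- ln (e n))" for w
  proof -
    have "ln (e n) \<le> ln (max (e n) (f w))" using e(1)[of n] by (subst ln_le_cancel_iff) auto
    moreover have "ln (e n) \<le> 0" using e[of n] by simp
    ultimately show ?thesis unfolding N_def by (intro ennreal_leI) auto
  qed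
  have i2: "integrable W (\<lambda>w. max 0 (- ln (max (e n) (f w))))"
  proof (rule integrableI_nonneg)
    have "(\<integral>\<^sup>+ w. N n w \<partial>W) \<le> (\<integral>\<^sup>+ w. ennreal (- ln (e n)) \<partial>W)" by (intro nn_integral_mono Nle)
    also have "\<dots> = ennreal (- ln (e n))" by (simp add: W.emeasure_space_1)
    also have "\<dots> < \<infinity>" by simp
    finally show "(\<integral>\<^sup>+ w. ennreal (max 0 (- ln (max (e n) (f w)))) \<partial>W) < \<infinity>" by (simp add: N_def)
  qed auto
  have i1: "integrable W (\<lambda>w. max 0 (ln (f w)))"
  proof (rule integrableI_nonneg)
    show "(\<integral>\<^sup>+ w. ennreal (max 0 (ln (f w))) \<partial>W) < \<infinity>"
      using n unfolding I_def by (rule order_less_le_trans) simp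
  qed auto
  have "ennreal (\<integral>w. max 0 (ln (f w)) \<partial>W) < ennreal (\<integral>w. max 0 (- ln (max (e n) (f w))) \<partial>W)"
    using n unfolding I_def N_def
    using nn_integral_eq_integral[OF i1] nn_integral_eq_integral[OF i2] by simp
  then have lt: "(\<integral>w. max 0 (ln (f w)) \<partial>W) < (\<integral>w. max 0 (- ln (max (e n) (f w))) \<partial>W)"
    by (subst (asm) ennreal_less_iff) (auto intro: integral_nonneg_AE)
  show ?thesis
  proof (rule that[of "e n"])
    show "integrable W (\<lambda>w. ln (max (e n) (Lam (obs w 0))))"
      unfolding f_def[symmetric] eqf using i1 i2 by (rule Bochner_Integration.integrable_diff)
    show "(\<integral>w. ln (max (e n) (Lam (obs w 0))) \<partial>W) < 0"
      unfolding f_def[symmetric] eqf using lt i1 i2 by simp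
  qed (rule e)
qed

text \<open>The logarithm of the product is a sum along the shift; its drift is negative after
  truncation, and bounded sums with \<open>\<kappa>\<close> added per step give decay at rate
  \<open>\<kappa>\<close>.\<close>

lemma AE_prod_Lam_decay:
  assumes s: "s \<noteq> 0"
  shows "AE w in W. \<forall>t. exp_decay (\<lambda>n. \<Prod>i<n. Lam (obs w (t + s * int i)))"
proof -
  obtain \<eta> where \<eta>: "0 < \<eta>" and i: "integrable W (\<lambda>w. ln (max \<eta> (Lam (obs w 0))))"
    and neg: "(\<integral>w. ln (max \<eta> (Lam (obs w 0))) \<partial>W) < 0" by (rule truncated_log_Lam)
  \<comment> \<open>Half the absolute mean: the summand plus \<open>\<kappa>\<close> still has
    negative mean.\<close>
  define \<kappa> where "\<kappa> = - (\<integral>w. ln (max \<eta> (Lam (obs w 0))) \<partial>W) / 2"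
  have \<kappa>: "\<kappa> > 0" using neg by (simp add: \<kappa>_def)
  have "AE w in W. \<exists>C. \<forall>n. (\<Sum>t<n. ln (max \<eta> (Lam (obs (tshift (s * int t) w) 0))) + \<kappa>) \<le> C"
  proof (rule shift_sums_bounded[OF s])
    show "integrable W (\<lambda>w. ln (max \<eta> (Lam (obs w 0))) + \<kappa>)" using i by simp
    show "(\<integral>w. ln (max \<eta> (Lam (obs w 0))) + \<kappa> \<partial>W) < 0"
      using i neg by (simp add: W.prob_space \<kappa>_def)
  qed
  then have "AE w in W. exp_decay (\<lambda>n. \<Prod>i<n. Lam (obs w (s * int i)))"
  proof (rule AE_mp, intro AE_I2 impI)
    fix w assume "\<exists>C. \<forall>n. (\<Sum>t<n. ln (max \<eta> (Lam (obs (tshift (s * int t) w) 0))) + \<kappa>) \<le> C"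
    then obtain C where C: "\<And>n. (\<Sum>t<n. ln (max \<eta> (Lam (obs w (s * int t)))) + \<kappa>) \<le> C"
      by (auto simp: obs_tshift)
    have "\<bar>\<Prod>i<n. Lam (obs w (s * int i))\<bar> \<le> exp C * exp (- \<kappa> * real n)" for n
    proof -
      have "\<bar>\<Prod>i<n. Lam (obs w (s * int i))\<bar> = (\<Prod>i<n. Lam (obs w (s * int i)))"
        by (simp add: prod_nonneg Lam_nonneg)
      also have "\<dots> \<le> (\<Prod>i<n. max \<eta> (Lam (obs w (s * int i))))"
        by (intro prod_mono) (auto simp: Lam_nonneg)
      also have "\<dots> = (\<Prod>i<n. exp (ln (max \<eta> (Lam (obs w (s * int i))))))"
        using \<eta> by (intro prod.cong refl) (simp add: less_max_iff_disj)
      also have "\<dots> = exp (\<Sum>i<n. ln (max \<eta> (Lam (obs w (s * int i)))))" by (simp add: exp_sum)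
      also have "\<dots> \<le> exp (C + - \<kappa> * real n)"
        using C[of n] by (simp add: sum.distrib algebra_simps)
      finally show ?thesis by (simp only: exp_add)
    qed
    then show "exp_decay (\<lambda>n. \<Prod>i<n. Lam (obs w (s * int i)))" unfolding exp_decay_def using \<kappa> by blast
  qed
  from AE_all_shift[OF this] show ?thesis
    by (rule AE_mp) (intro AE_I2 impI, simp add: obs_tshift add.commute)
qed

lemma AE_good_past: "AE w in W. \<forall>t. good_past (obs w) t"
  using AE_prod_Lam_decay[of "-1", simplified] subexp_obs[of "-1", simplified]
proof eventually_elim
  case (elim w)
  show ?case
  proof
    fix t show "good_past (obs w) t"
      using elim(1)[rule_format, of "t - 1"] elim(2)[rule_format, of "t - 1"] by (simp add: good_past_def)
  qed
qed

lemma AE_forward: "AE w in W. exp_decay (\<lambda>n. \<Prod>i<n. Lam (obs w (int i))) \<and> subexp (\<lambda>n. obs w (int n))"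
  using AE_prod_Lam_decay[of 1, simplified] subexp_obs[of 1, simplified]
proof eventually_elim
  case (elim w)
  show ?case using elim(1)[rule_format, of 0] elim(2)[rule_format, of 0] by simp
qed

lemma measurable_back [measurable]: "(\<lambda>w. egarch_back th (obs w) k t) \<in> borel_measurable W"
  by (induction k arbitrary: t) (auto simp: egarch_step_def news_def)

lemma measurable_h [measurable]: "(\<lambda>w. egarch_h th (obs w) t) \<in> borel_measurable W"
  unfolding egarch_h_def by measurable

lemma AE_logvol_rec: "AE w in W. (\<forall>t. logvol w (t + 1) = par_alpha th0 + par_beta th0 * logvol w t + news th0 (w t))
    \<and> (\<forall>t. egarch_lo th0 \<le> logvol w t)"
  using AE_summable by (rule AE_mp) (intro AE_I2 impI conjI allI logvol_rec logvol_ge; blast)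

lemma AE_h_th0: "AE w in W. \<forall>t. egarch_h th0 (obs w) t = logvol w t"
  using AE_good_past AE_logvol_rec subexp_obs[of "-1", simplified]
proof eventually_elim
  case (elim w)
  show ?case
  proof
    fix t
    show "egarch_h th0 (obs w) t = logvol w t"
    proof (rule h_unique[OF th0_K])
      show "logvol w (t + 1) = egarch_step th0 (obs w t) (logvol w t)" for t
        using elim(2) by (simp add: step_obs)
      show "subexp (\<lambda>k. logvol w (t - int k))" using elim(3) by simp
    qed (use elim in auto)
  qed
qed

end

section \<open>Identifiability and consistency\<close>

text \<open>Only observations strictly before \<open>t\<close> enter. Hence the volatility at time 0
  is unchanged when the innovation at time 0 is resampled.\<close>

lemma egarch_back_cong:
  assumes "\<And>u. u < t \<Longrightarrow> x u = x' u"
  shows "egarch_back th x k t = egarch_back th x' k t"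
  using assms by (induction k arbitrary: t) auto

lemma egarch_h_cong:
  assumes "\<And>u. u < t \<Longrightarrow> x u = x' u"
  shows "egarch_h th x t = egarch_h th x' t"
  unfolding egarch_h_def using egarch_back_cong[of t x x' th, OF assms] by simp

lemma egarch_back_shift: "egarch_back th (\<lambda>u. x (u + s)) k t = egarch_back th x k (t + s)"
  by (induction k arbitrary: t) (auto simp: algebra_simps)

lemma egarch_h_shift: "egarch_h th (\<lambda>u. x (u + s)) t = egarch_h th x (t + s)"
  unfolding egarch_h_def egarch_back_shift ..

lemma exp_ge_add_one_less: "(u::real) \<noteq> 0 \<Longrightarrow> 1 + u < exp u"
proof -
  assume "u \<noteq> 0"
  then have "exp u \<noteq> 1 + u" using ln_eq_minus_one[of "exp u"] by auto
  then show ?thesis using exp_ge_add_one_self[of u] by linarith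
qed

section \<open>Affine relations between an innovation and its absolute value\<close>

context egarch_model
begin

lemma AE_two_points_False: "\<not> (AE z in D. z \<in> {p, q})"
proof
  assume "AE z in D. z \<in> {p, q}"
  moreover have "{p, q} \<in> sets D" by (simp add: sets_D)
  ultimately have "measure D {p, q} = 1" by (simp add: D.prob_eq_1)
  then show False using D_not2[of p q] by simp
qed

text \<open>A centred variable of constant sign is almost surely zero, which contradicts the unit
  second moment.\<close>

lemma AE_sign_False:
  assumes c: "c \<noteq> 0" and "AE z in D. 0 \<le> c * z"
  shows False
proof -
  have "integrable D (\<lambda>z. c * z)" "(\<integral>z. c * z \<partial>D) = 0" using D_int D_mean by simp_all
  then have "AE z in D. c * z = 0" using assms(2) by (subst (asm) integral_nonneg_eq_0_iff_AE) auto
  then have "AE z in D. z\<^sup>2 = 0" by (rule AE_mp) (use c in simp)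
  then have "(\<integral>z. z\<^sup>2 \<partial>D) = (\<integral>z. 0 \<partial>D)" 
    using borel_measurable_integrable[OF D_int2] by (intro integral_cong_AE) auto
  then show False using D_var by simp
qed

text \<open>On each half-line the relation is linear. With \<open>A \<noteq> 0\<close> it has at
  most one root on each side, giving two points in all; with \<open>A = 0\<close> a nonzero slope on
  one side excludes that side, so the innovation has constant sign.\<close>

lemma affine_abs_eq_0_AE:
  assumes "AE z in D. A + B * z + E * \<bar>z\<bar> = 0"
  shows "A = 0" "B = 0" "E = 0"
proof -
  have pos: "z = - A / (B + E)" if "A + B * z + E * \<bar>z\<bar> = 0" "z \<ge> 0" "B + E \<noteq> 0" for z
  proof -
    have "z * (B + E) = - A" using that by (simp add: algebra_simps)
    then show ?thesis using that(3) by (metis nonzero_eq_divide_eq)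
  qed
  have neg: "z = - A / (B - E)" if "A + B * z + E * \<bar>z\<bar> = 0" "z < 0" "B - E \<noteq> 0" for z
  proof -
    have "z * (B - E) = - A" using that by (simp add: algebra_simps)
    then show ?thesis using that(3) by (metis nonzero_eq_divide_eq)
  qed
  have A0: "A = 0"
  proof (rule ccontr)
    assume A: "A \<noteq> 0"
    \<comment> \<open>If a denominator is zero, the corresponding half-line contains no root, so the
      meaningless quotient does no harm.\<close>
    have "AE z in D. z \<in> {- A / (B + E), - A / (B - E)}"
      using assms
    proof (rule AE_mp, intro AE_I2 impI)
      fix z assume z: "A + B * z + E * \<bar>z\<bar> = 0"
      show "z \<in> {- A / (B + E), - A / (B - E)}"
      proof (cases "z \<ge> 0")
        case True
        have "B + E \<noteq> 0"
        proof
          assume "B + E = 0"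
          then have "B = - E" by simp
          then show False using z A True by simp
        qed
        then show ?thesis using pos[OF z True] by simp
      next
        case False
        have "B - E \<noteq> 0" using z A False by auto
        then show ?thesis using neg[OF z] False by simp
      qed
    qed
    then show False using AE_two_points_False by blast
  qed
  have BE: "B + E = 0 \<and> B - E = 0"
  proof (rule ccontr)
    assume ne: "\<not> (B + E = 0 \<and> B - E = 0)"
    show False
    proof (cases "B + E = 0")
      case True
      then have "B - E \<noteq> 0" using ne by simp
      then have "z \<ge> 0" if "A + B * z + E * \<bar>z\<bar> = 0" for z
        using neg[OF that] A0 by (cases "z < 0") auto
      then have "AE z in D. 0 \<le> 1 * z" using assms by (auto elim!: AE_mp)
      then show False using AE_sign_False[of 1] by simp
    next
      case False
      then have "z \<le> 0" if "A + B * z + E * \<bar>z\<bar> = 0" for z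
        using pos[OF that] A0 by (cases "z \<ge> 0") auto
      then have "AE z in D. 0 \<le> -1 * z" using assms by (auto elim!: AE_mp)
      then show False using AE_sign_False[of "-1"] by simp
    qed
  qed
  show "A = 0" by (rule A0)
  show "B = 0" "E = 0" using BE by linarith+
qed

lemma logvol_past: "t \<le> 0 \<Longrightarrow> logvol (w(0 := z)) t = logvol w t"
  by (simp add: logvol_def)

lemma obs_past: "t < 0 \<Longrightarrow> obs (w(0 := z)) t = obs w t"
  by (simp add: obs_def logvol_past)

lemma h_past: "egarch_h th (obs (w(0 := z))) 0 = egarch_h th (obs w) 0"
  by (rule egarch_h_cong) (simp add: obs_past)

text \<open>After resampling, \<open>c w\<close> is a constant for fixed \<open>w\<close> and
  \<open>affine_abs_eq_0_AE\<close> applies path by path.\<close>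

lemma innovation_affine_eq_0:
  assumes "AE w in W. c w + B * w 0 + E * \<bar>w 0\<bar> = 0" and "\<And>w z. c (w(0 := z)) = c w"
  shows "B = 0" "E = 0" "AE w in W. c w = 0"
proof -
  have a: "AE w in W. AE z in D. c w + B * z + E * \<bar>z\<bar> = 0"
    using AE_resample[OF assms(1)] by (simp add: assms(2))
  then have "AE w in W. B = 0 \<and> E = 0 \<and> c w = 0"
  proof (rule AE_mp, intro AE_I2 impI)
    fix w assume "AE z in D. c w + B * z + E * \<bar>z\<bar> = 0"
    from affine_abs_eq_0_AE[OF this] show "B = 0 \<and> E = 0 \<and> c w = 0" by simp
  qed
  then show "AE w in W. c w = 0" and "B = 0" "E = 0"
    by (auto simp: AE_conj_iff W.AE_const)
qed

text \<open>Integrating out the innovation at time 0, which is independent of the past and has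
  second moment 1, replaces the squared observation by its conditional variance.\<close>

lemma nn_integral_loss:
  assumes v [measurable]: "v \<in> borel_measurable W" and past: "\<And>w z. v (w(0 := z)) = v w"
    and ge: "AE w in W. m \<le> v w"
  shows "(\<integral>\<^sup>+w. ennreal (egarch_loss (obs w 0) (v w) - m) \<partial>W)
    = (\<integral>\<^sup>+w. ennreal (exp (logvol w 0 - v w) + v w - m) \<partial>W)"
proof -
  have loss: "egarch_loss (obs w 0) (v w) - m = (w 0)\<^sup>2 * exp (logvol w 0 - v w) + (v w - m)" for w
  proof -
    have "(obs w 0)\<^sup>2 = (w 0)\<^sup>2 * exp (logvol w 0)"
      by (simp add: obs_def power_mult_distrib exp_double[symmetric] mult.commute)
    then show ?thesis by (simp add: egarch_loss_def exp_diff)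
  qed
  let ?f = "\<lambda>w. ennreal ((w 0)\<^sup>2 * exp (logvol w 0 - v w) + (v w - m))"
  have "(\<integral>\<^sup>+w. ?f w \<partial>W) = (\<integral>\<^sup>+w. (\<integral>\<^sup>+z. ?f (w(0 := z)) \<partial>D) \<partial>W)"
    by (rule nn_integral_resample) measurable
  also have "\<dots> = (\<integral>\<^sup>+w. ennreal (exp (logvol w 0 - v w) + v w - m) \<partial>W)"
  proof (rule nn_integral_cong_AE, use ge in eventually_elim)
    fix w assume vm: "m \<le> v w"
    let ?e = "exp (logvol w 0 - v w)"
    have "(\<integral>\<^sup>+z. ?f (w(0 := z)) \<partial>D) = (\<integral>\<^sup>+z. ennreal (z\<^sup>2 * ?e + (v w - m)) \<partial>D)"
      by (simp add: past logvol_past)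
    also have "\<dots> = ennreal (\<integral>z. z\<^sup>2 * ?e + (v w - m) \<partial>D)"
      using vm D_int2 by (intro nn_integral_eq_integral) auto
    also have "(\<integral>z. z\<^sup>2 * ?e + (v w - m) \<partial>D) = ?e + v w - m"
      using D_int2 D_var by (simp add: D.prob_space)
    finally show "(\<integral>\<^sup>+z. ?f (w(0 := z)) \<partial>D) = ennreal (?e + v w - m)" .
  qed
  finally show ?thesis unfolding loss .
qed

end

section \<open>Identification of the true parameter by the expected loss\<close>

context egarch_qmle
begin

lemma h_tshift: "egarch_h th (obs (tshift s w)) t = egarch_h th (obs w) (t + s)"
proof -
  have "obs (tshift s w) = (\<lambda>u. obs w (u + s))" by (simp add: fun_eq_iff obs_tshift)
  then show ?thesis by (simp only: egarch_h_shift)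
qed

text \<open>If both parameters generate the same stationary volatility, subtracting their recursions
  gives an affine relation in the present innovation with coefficients \<open>?g\<close> and
  \<open>?d\<close>, which must vanish.\<close>

lemma identifiable:
  assumes th: "th \<in> K" and eq: "AE w in W. egarch_h th (obs w) 0 = logvol w 0"
  shows "th = th0"
proof -
  let ?a = "par_alpha th - par_alpha th0" and ?b = "par_beta th - par_beta th0"
    and ?g = "par_gamma th - par_gamma th0" and ?d = "par_delta th - par_delta th0"
  have eq': "AE w in W. \<forall>t. egarch_h th (obs w) t = logvol w t"
    using AE_all_shift[OF eq] by (simp add: h_tshift logvol_tshift)
  have "AE w in W. (?a + ?b * logvol w 0) + ?g * w 0 + ?d * \<bar>w 0\<bar> = 0"
    using eq' AE_good_past AE_logvol_rec
  proof eventually_elim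
    case (elim w)
    have "logvol w (0 + 1) = egarch_step th (obs w 0) (logvol w 0)"
      using h_rec[of "obs w" 0 th] elim(1,2) th by simp
    also have "\<dots> = par_alpha th + par_beta th * logvol w 0 + news th (w 0)" by (rule step_obs)
    finally show ?case using elim(3)[THEN conjunct1, rule_format, of 0]
      by (simp add: news_def algebra_simps)
  qed
  note * = innovation_affine_eq_0[OF this]
  have g: "?g = 0" and d: "?d = 0" and c: "AE w in W. ?a + ?b * logvol w 0 = 0"
    using * by (simp_all add: logvol_past)
  \<comment> \<open>The remaining relation involves only the past. One step later it contains the
    innovation again, with coefficients \<open>?b * par_gamma th0\<close> and
    \<open>?b * par_delta th0\<close>, not both of which have a zero second factor.\<close>
  have "AE w in W. ?a + ?b * logvol w 1 = 0"
    using AE_shift[OF c, of 1] by (simp add: logvol_tshift)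
  then have "AE w in W. (?a + ?b * (par_alpha th0 + par_beta th0 * logvol w 0))
      + (?b * par_gamma th0) * w 0 + (?b * par_delta th0) * \<bar>w 0\<bar> = 0"
    using AE_logvol_rec
  proof eventually_elim
    case (elim w)
    show ?case using elim(1) elim(2)[THEN conjunct1, rule_format, of 0]
      by (simp add: news_def algebra_simps)
  qed
  note ** = innovation_affine_eq_0[OF this]
  have "?b * par_gamma th0 = 0" "?b * par_delta th0 = 0" using ** by (simp_all add: logvol_past)
  then have b: "?b = 0" using th0_nontrivial by auto
  then have "?a = 0" using c by (simp add: W.AE_const)
  then show ?thesis using b g d
    by (simp add: par_alpha_def par_beta_def par_gamma_def par_delta_def prod_eq_iff)
qed

lemma AE_h_ge: "th \<in> K \<Longrightarrow> AE w in W. \<forall>t. egarch_m K \<le> egarch_h th (obs w) t"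
  using AE_good_past
  by (rule AE_mp) (intro AE_I2 impI allI, blast intro: order_trans[OF m_le_lo h_ge_lo])

lemma AE_logvol_ge: "AE w in W. egarch_m K \<le> logvol w t"
  using AE_h_ge[OF th0_K] AE_h_th0 by eventually_elim simp

text \<open>With the innovation integrated out, \<open>1 + u \<le> exp u\<close> is applied to the
  difference \<open>u\<close> of true and candidate log-volatility; equality almost everywhere would
  give \<open>u = 0\<close>, which \<open>identifiable\<close> excludes.\<close>

lemma loss_nn_integral_less:
  assumes th: "th \<in> K" and ne: "th \<noteq> th0"
  shows "(\<integral>\<^sup>+w. ennreal (egarch_loss (obs w 0) (logvol w 0) - egarch_m K) \<partial>W)
    < (\<integral>\<^sup>+w. ennreal (egarch_loss (obs w 0) (egarch_h th (obs w) 0) - egarch_m K) \<partial>W)"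
proof -
  let ?m = "egarch_m K" and ?h = "\<lambda>w. egarch_h th (obs w) 0" and ?Y = "\<lambda>w. logvol w 0"
  have hge: "AE w in W. ?m \<le> ?h w" using AE_h_ge[OF th] by (rule AE_mp) simp
  have 1: "(\<integral>\<^sup>+w. ennreal (egarch_loss (obs w 0) (?Y w) - ?m) \<partial>W) = (\<integral>\<^sup>+w. ennreal (1 + ?Y w - ?m) \<partial>W)"
    using nn_integral_loss[of ?Y ?m] AE_logvol_ge by (simp add: logvol_past)
  have 2: "(\<integral>\<^sup>+w. ennreal (egarch_loss (obs w 0) (?h w) - ?m) \<partial>W)
      = (\<integral>\<^sup>+w. ennreal (exp (?Y w - ?h w) + ?h w - ?m) \<partial>W)"
    using hge by (intro nn_integral_loss h_past) auto
  have "(\<integral>\<^sup>+w. ennreal (1 + ?Y w - ?m) \<partial>W) < (\<integral>\<^sup>+w. ennreal (exp (?Y w - ?h w) + ?h w - ?m) \<partial>W)"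
  proof (rule nn_integral_less)
    \<comment> \<open>Strict comparison needs the smaller integral to be finite; the other one may
      be infinite.\<close>
    have "(\<integral>\<^sup>+w. ennreal (1 + ?Y w - ?m) \<partial>W) = ennreal (\<integral>w. 1 + ?Y w - ?m \<partial>W)"
      using integrable_logvol[of 0] AE_logvol_ge[of 0] by (intro nn_integral_eq_integral) auto
    then show "(\<integral>\<^sup>+w. ennreal (1 + ?Y w - ?m) \<partial>W) \<noteq> \<infinity>" by simp
    have le: "1 + ?Y w - ?m \<le> exp (?Y w - ?h w) + ?h w - ?m" for w
      using exp_ge_add_one_self[of "?Y w - ?h w"] by linarith
    show "AE w in W. ennreal (1 + ?Y w - ?m) \<le> ennreal (exp (?Y w - ?h w) + ?h w - ?m)"
      by (intro AE_I2 ennreal_leI le)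
    show "\<not> (AE w in W. ennreal (exp (?Y w - ?h w) + ?h w - ?m) \<le> ennreal (1 + ?Y w - ?m))"
    proof
      assume "AE w in W. ennreal (exp (?Y w - ?h w) + ?h w - ?m) \<le> ennreal (1 + ?Y w - ?m)"
      then have "AE w in W. ?h w = ?Y w"
        using AE_logvol_ge[of 0]
      proof eventually_elim
        case (elim w)
        then have "exp (?Y w - ?h w) + ?h w - ?m \<le> 1 + ?Y w - ?m" by (subst (asm) ennreal_le_iff) auto
        then have "?Y w - ?h w = 0" using exp_ge_add_one_less[of "?Y w - ?h w"] by (auto intro: ccontr)
        then show ?case by simp
      qed
      then show False using identifiable[OF th] ne by blast
    qed
  qed measurable
  then show ?thesis unfolding 1 2 .
qed

section \<open>A linear loss gap near a wrong parameter\<close>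

lemma continuous_loss_h:
  "good_past (obs w) t \<Longrightarrow> continuous_on K (\<lambda>th. egarch_loss (obs w t) (egarch_h th (obs w) t))"
  unfolding egarch_loss_def by (intro continuous_intros continuous_h) auto

lemma integrable_loss0: "integrable W (\<lambda>w. egarch_loss (obs w 0) (logvol w 0))"
proof -
  have "egarch_loss (obs w 0) (logvol w 0) = (w 0)\<^sup>2 + logvol w 0" for w
    by (simp add: egarch_loss_def obs_def power_mult_distrib exp_double[symmetric])
  then show ?thesis using integrable_coord[OF D_int2] integrable_logvol by simp
qed

text \<open>As the ball shrinks, the infimum of the loss over it increases to the loss at
  \<open>th1\<close>, so for a small ball its mean still exceeds the mean loss at
  \<open>th0\<close>. The ergodic bound for this single function covers all parameters in the
  ball.\<close>

lemma loss_sum_gap: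
  assumes th1: "th1 \<in> K" and ne: "th1 \<noteq> th0"
  shows "\<exists>r>0. \<exists>c>0. AE w in W. \<exists>C. \<forall>n. \<forall>th\<in>K \<inter> ball th1 r.
    (\<Sum>t=1..n. egarch_loss (obs w (int t)) (logvol w (int t))
       - egarch_loss (obs w (int t)) (egarch_h th (obs w) (int t))) \<le> C - c * real n"
proof -
  \<comment> \<open>Infima over a countable dense subset are measurable.\<close>
  obtain Q where Q: "countable Q" "Q \<subseteq> K" "K \<subseteq> closure Q" using separable[of K] by blast
  let ?m = "egarch_m K"
  define l where "l th w = egarch_loss (obs w 0) (egarch_h th (obs w) 0)" for th w
  define l0 where "l0 w = egarch_loss (obs w 0) (logvol w 0)" for w
  define r where "r i = inverse (real (Suc i))" for i
  define g where "g i w = (INF th\<in>Q \<inter> ball th1 (r i). ennreal (l th w - ?m))" for i w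
  \<comment> \<open>Truncation at level \<open>i\<close> makes the function bounded, hence
    integrable, and the sequence still increases to the required limit.\<close>
  define f where "f i w = min (g i w) (of_nat i)" for i w
  have r0: "r i > 0" for i by (simp add: r_def)
  have r_anti: "r j \<le> r i" if "i \<le> j" for i j using that unfolding r_def by (auto simp: field_simps)
  have lm [measurable]: "l th \<in> borel_measurable W" for th
    unfolding l_def egarch_loss_def by measurable
  have gm [measurable]: "g i \<in> borel_measurable W" for i
    unfolding g_def using Q(1) by (intro borel_measurable_INF) auto
  have fm [measurable]: "f i \<in> borel_measurable W" for i unfolding f_def by measurable
  have cont: "continuous_on K (\<lambda>th. l th w)" if "good_past (obs w) 0" for w
    unfolding l_def using that by (rule continuous_loss_h)
  have finc: "incseq f"
  proof (rule incseq_SucI, rule le_funI)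
    fix i w
    have "ball th1 (r (Suc i)) \<subseteq> ball th1 (r i)" using r_anti[of i "Suc i"] by (intro subset_ball) auto
    then have "g i w \<le> g (Suc i) w" unfolding g_def by (intro INF_superset_mono) auto
    then show "f i w \<le> f (Suc i) w" unfolding f_def by (intro min.mono) (auto simp: ennreal_of_nat_eq_real_of_nat intro: ennreal_leI)
  qed
  have fsup: "ennreal (l th1 w - ?m) \<le> (SUP i. f i w)" if gp: "good_past (obs w) 0" for w
  proof (rule ennreal_le_epsilon)
    fix e :: real assume e: "0 < e"
    obtain d where d: "d > 0" "\<And>th. th \<in> K \<Longrightarrow> dist th th1 < d \<Longrightarrow> dist (l th w) (l th1 w) < e"
      using cont[OF gp] th1 e unfolding continuous_on_iff by blast
    obtain i1 where i1: "r i1 < d" using reals_Archimedean[OF d(1)] unfolding r_def by blast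
    obtain i2 :: nat where i2: "l th1 w - ?m - e \<le> real i2" using real_arch_simple by blast
    let ?i = "max i1 i2"
    have "ennreal (l th1 w - ?m - e) \<le> g ?i w"
      unfolding g_def
    proof (rule INF_greatest)
      fix th assume th: "th \<in> Q \<inter> ball th1 (r ?i)"
      have "r ?i \<le> r i1" by (rule r_anti) simp
      then have "dist th th1 < d" using th i1 by (simp add: dist_commute)
      then have "dist (l th w) (l th1 w) < e" using d(2) th Q(2) by blast
      then show "ennreal (l th1 w - ?m - e) \<le> ennreal (l th w - ?m)"
        by (intro ennreal_leI) (simp add: dist_real_def abs_less_iff)
    qed
    moreover have "ennreal (l th1 w - ?m - e) \<le> of_nat ?i"
      unfolding ennreal_of_nat_eq_real_of_nat using i2 by (intro ennreal_leI) simp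
    ultimately have "ennreal (l th1 w - ?m - e) \<le> f ?i w" by (simp add: f_def)
    also have "\<dots> \<le> (SUP i. f i w)" by (rule SUP_upper) simp
    finally have "ennreal (l th1 w - ?m - e) + ennreal e \<le> (SUP i. f i w) + ennreal e" by (rule add_right_mono)
    moreover have "ennreal (l th1 w - ?m) \<le> ennreal (l th1 w - ?m - e) + ennreal e"
    proof (cases "l th1 w - ?m - e \<ge> 0")
      case True then show ?thesis using e by (simp add: ennreal_plus[symmetric] del: ennreal_plus)
    next
      case False
      then have "ennreal (l th1 w - ?m) \<le> ennreal e" by (intro ennreal_leI) simp
      then show ?thesis by (rule order_trans) simp
    qed
    ultimately show "ennreal (l th1 w - ?m) \<le> (SUP i. f i w) + ennreal e" by (rule order_trans[rotated])
  qed
  have "(\<integral>\<^sup>+w. ennreal (l0 w - ?m) \<partial>W) < (\<integral>\<^sup>+w. ennreal (l th1 w - ?m) \<partial>W)"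
    unfolding l0_def l_def by (rule loss_nn_integral_less[OF th1 ne])
  also have "\<dots> \<le> (\<integral>\<^sup>+w. (SUP i. f i w) \<partial>W)"
    using AE_good_past by (intro nn_integral_mono_AE) (rule AE_mp, auto intro: fsup)
  also have "\<dots> = (SUP i. \<integral>\<^sup>+w. f i w \<partial>W)"
    using finc by (intro nn_integral_monotone_convergence_SUP) auto
  finally obtain i where i: "(\<integral>\<^sup>+w. ennreal (l0 w - ?m) \<partial>W) < (\<integral>\<^sup>+w. f i w \<partial>W)"
    unfolding less_SUP_iff by blast
  define G where "G w = enn2real (f i w)" for w
  have f_fin: "f i w \<noteq> \<top>" for w
    unfolding f_def by (metis ennreal_of_nat_neq_top min.cobounded2 neq_top_trans)
  have fG: "f i w = ennreal (G w)" for w using f_fin by (simp add: G_def less_top)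
  have Gb: "0 \<le> G w" "G w \<le> real i" for w
  proof -
    show "0 \<le> G w" by (simp add: G_def)
    have "ennreal (G w) \<le> ennreal (real i)"
      unfolding fG[symmetric] f_def ennreal_of_nat_eq_real_of_nat[symmetric] by simp
    then show "G w \<le> real i" by simp
  qed
  have Gm [measurable]: "G \<in> borel_measurable W" unfolding G_def by measurable
  have Gi: "integrable W G"
    by (rule W.integrable_const_bound[of _ "real i"]) (use Gb in auto)
  have l0i: "integrable W (\<lambda>w. l0 w - ?m)" unfolding l0_def using integrable_loss0 by simp
  have l0ge: "AE w in W. 0 \<le> l0 w - ?m"
    using AE_logvol_ge[of 0]
  proof eventually_elim
    case (elim w)
    have "0 \<le> (obs w 0)\<^sup>2 / exp (logvol w 0)" by simp
    then show ?case using elim unfolding l0_def egarch_loss_def by linarith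
  qed
  have "ennreal (\<integral>w. l0 w - ?m \<partial>W) < ennreal (\<integral>w. G w \<partial>W)"
    using i nn_integral_eq_integral[OF l0i l0ge] nn_integral_eq_integral[OF Gi] Gb(1) unfolding fG by simp
  then have lt: "(\<integral>w. l0 w - ?m \<partial>W) < (\<integral>w. G w \<partial>W)"
    by (subst (asm) ennreal_less_iff) (auto intro: integral_nonneg_AE l0ge)
  \<comment> \<open>Half the gap between the means: adding it in \<open>F\<close> leaves the mean
    \<open>- c\<close>, still negative.\<close>
  define c where "c = ((\<integral>w. G w \<partial>W) - (\<integral>w. l0 w - ?m \<partial>W)) / 2"
  have c: "c > 0" using lt by (simp add: c_def)
  define F where "F w = (l0 w - ?m) - G w + c" for w
  have "integrable W F" unfolding F_def using l0i Gi by auto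
  moreover have "(\<integral>w. F w \<partial>W) < 0"
  proof -
    have "(\<integral>w. F w \<partial>W) = (\<integral>w. l0 w - ?m \<partial>W) - (\<integral>w. G w \<partial>W) + c"
      unfolding F_def using l0i Gi by (simp add: W.prob_space)
    also have "\<dots> = - c" by (simp add: c_def field_simps)
    finally show ?thesis using c by simp
  qed
  ultimately have sums: "AE w in W. \<exists>C. \<forall>n. (\<Sum>t<n. F (tshift (1 * int t) w)) \<le> C"
    by (intro shift_sums_bounded) auto
  \<comment> \<open>The ball is open and the loss continuous in the parameter, so the bound passes
    from \<open>Q\<close> to every point of \<open>K\<close> in the ball.\<close>
  have Gle: "G w \<le> l th w - ?m"
    if gp: "good_past (obs w) 0" and th: "th \<in> K \<inter> ball th1 (r i)" for w th
  proof (rule field_le_epsilon)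
    fix e :: real assume e: "0 < e"
    obtain d where d: "d > 0" "\<And>q. q \<in> K \<Longrightarrow> dist q th < d \<Longrightarrow> dist (l q w) (l th w) < e"
      using cont[OF gp] th e unfolding continuous_on_iff by blast
    have thc: "th \<in> closure Q" using th Q(3) by blast
    have "min d (r i - dist th1 th) > 0" using d(1) th by simp
    then obtain q where q: "q \<in> Q" "dist q th < min d (r i - dist th1 th)"
      using thc unfolding closure_approachable by blast
    have "dist th1 q \<le> dist th1 th + dist q th" by (metis dist_commute dist_triangle)
    then have qb: "q \<in> Q \<inter> ball th1 (r i)" using q by simp
    have "dist (l q w) (l th w) < e" using d(2)[of q] q Q(2) by auto
    then have le: "l q w \<le> l th w + e" by (simp add: dist_real_def abs_less_iff)
    \<comment> \<open>\<open>ennreal\<close> sends negative numbers to 0, so the inequality can be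
      read back in the reals only for a nonnegative right side.\<close>
    have ge: "l q w - ?m \<ge> 0"
    proof -
      have qK: "q \<in> K" using q Q(2) by blast
      have "0 \<le> (obs w 0)\<^sup>2 / exp (egarch_h q (obs w) 0)" by simp
      then show ?thesis using h_ge_lo[OF gp qK] m_le_lo[OF qK] unfolding l_def egarch_loss_def by linarith
    qed
    have "ennreal (G w) \<le> g i w" unfolding fG[symmetric] f_def by simp
    also have "\<dots> \<le> ennreal (l q w - ?m)" unfolding g_def using qb by (rule INF_lower)
    finally have "G w \<le> l q w - ?m" using ge by simp
    then show "G w \<le> l th w - ?m + e" using le by simp
  qed
  have "AE w in W. \<exists>C. \<forall>n. \<forall>th\<in>K \<inter> ball th1 (r i).
    (\<Sum>t=1..n. egarch_loss (obs w (int t)) (logvol w (int t))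
       - egarch_loss (obs w (int t)) (egarch_h th (obs w) (int t))) \<le> C - c * real n"
    using sums AE_good_past
  proof eventually_elim
    case (elim w)
    obtain C where C: "\<And>n. (\<Sum>t<n. F (tshift (int t) w)) \<le> C" using elim(1) by auto
    have "(\<Sum>t=1..n. egarch_loss (obs w (int t)) (logvol w (int t))
       - egarch_loss (obs w (int t)) (egarch_h th (obs w) (int t))) \<le> (C - F w) - c * real n"
      if th: "th \<in> K \<inter> ball th1 (r i)" for th n
    proof -
      have "egarch_loss (obs w (int t)) (logvol w (int t)) - egarch_loss (obs w (int t)) (egarch_h th (obs w) (int t))
          \<le> F (tshift (int t) w) - c" for t
      proof -
        have "obs (tshift (int t) w) = (\<lambda>u. obs w (u + int t))" by (simp add: fun_eq_iff obs_tshift)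
        then have "good_past (obs (tshift (int t) w)) 0"
          using elim(2)[rule_format, of "int t"] by (simp add: good_past_def algebra_simps)
        from Gle[OF this th] show ?thesis
          by (simp add: F_def l0_def l_def obs_tshift logvol_tshift h_tshift)
      qed
      then have "(\<Sum>t=1..n. egarch_loss (obs w (int t)) (logvol w (int t))
         - egarch_loss (obs w (int t)) (egarch_h th (obs w) (int t))) \<le> (\<Sum>t=1..n. F (tshift (int t) w) - c)"
        by (intro sum_mono)
      also have "\<dots> = (\<Sum>t=1..n. F (tshift (int t) w)) - c * real n" by (simp add: sum_subtractf)
      \<comment> \<open>The likelihood sums from 1, the ergodic bound from 0; the extra term
        \<open>F w\<close> is absorbed into the constant.\<close>
      also have "(\<Sum>t=1..n. F (tshift (int t) w)) = (\<Sum>t<Suc n. F (tshift (int t) w)) - F w"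
      proof -
        have "(\<Sum>t<Suc n. F (tshift (int t) w)) = F (tshift (int 0) w) + (\<Sum>t=1..n. F (tshift (int t) w))"
          unfolding sum.lessThan_Suc_shift
          by (subst sum.shift_bounds_Suc_ivl[symmetric, of _ 0 n, simplified atLeast0LessThan])
            (simp_all add: atLeastLessThanSuc_atLeastAtMost)
        then show ?thesis by simp
      qed
      finally show ?thesis using C[of "Suc n"] by simp
    qed
    then show ?case by blast
  qed
  then show ?thesis using c r0 by blast
qed

lemma lik_eq: "egarch_lik s th x n = - (1/2) * (\<Sum>t=1..n. egarch_loss (x t) (egarch_logh s th x t))"
  by (simp add: egarch_lik_def egarch_loss_def)

text \<open>The gap grows linearly while passing to the stationary volatility costs a bounded
  amount. The resulting threshold depends on the path only, so the quantifier over
  \<open>est\<close> may stand inside the almost sure statement.\<close>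

lemma AE_maximizer_avoids:
  assumes th1: "th1 \<in> K" and ne: "th1 \<noteq> th0"
  shows "\<exists>r>0. AE w in W. \<forall>est. (\<forall>n. est n \<in> K) \<longrightarrow>
      (\<forall>n. egarch_lik s th0 (\<lambda>t. obs w (int t)) n \<le> egarch_lik s (est n) (\<lambda>t. obs w (int t)) n) \<longrightarrow>
      (\<forall>\<^sub>F n in sequentially. est n \<notin> ball th1 r)"
proof -
  obtain r c where r: "r > 0" and c: "c > 0" and gap: "AE w in W. \<exists>C. \<forall>n. \<forall>th\<in>K \<inter> ball th1 r.
    (\<Sum>t=1..n. egarch_loss (obs w (int t)) (logvol w (int t))
       - egarch_loss (obs w (int t)) (egarch_h th (obs w) (int t))) \<le> C - c * real n"
    using loss_sum_gap[OF assms] by blast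
  have "AE w in W. \<forall>est. (\<forall>n. est n \<in> K) \<longrightarrow>
      (\<forall>n. egarch_lik s th0 (\<lambda>t. obs w (int t)) n \<le> egarch_lik s (est n) (\<lambda>t. obs w (int t)) n) \<longrightarrow>
      (\<forall>\<^sub>F n in sequentially. est n \<notin> ball th1 r)"
    using gap AE_good_past AE_forward AE_h_th0
  proof eventually_elim
    case (elim w)
    obtain C where C: "\<forall>n. \<forall>th\<in>K \<inter> ball th1 r.
      (\<Sum>t=1..n. egarch_loss (obs w (int t)) (logvol w (int t))
       - egarch_loss (obs w (int t)) (egarch_h th (obs w) (int t))) \<le> C - c * real n"
      using elim(1) by (rule exE)
    obtain C' where C': "\<forall>th\<in>K. \<forall>n. (\<Sum>t=1..n. \<bar>egarch_loss (obs w (int t)) (egarch_logh s th (\<lambda>t. obs w (int t)) t)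
      - egarch_loss (obs w (int t)) (egarch_h th (obs w) (int t))\<bar>) \<le> C'"
      using loss_sum_diff[of "obs w" s, OF elim(2)[rule_format] elim(3)[THEN conjunct1] elim(3)[THEN conjunct2]]
      by (rule exE)
    \<comment> \<open>\<open>C'\<close> is paid twice, once for \<open>th0\<close> and once for the
      estimate.\<close>
    obtain N :: nat where N: "(C + 2 * C') / c < real N" using reals_Archimedean2 by blast
    show ?case
    proof (intro allI impI)
      fix est :: "nat \<Rightarrow> egarch_param"
      assume K: "\<forall>n. est n \<in> K"
        and lik: "\<forall>n. egarch_lik s th0 (\<lambda>t. obs w (int t)) n \<le> egarch_lik s (est n) (\<lambda>t. obs w (int t)) n"
      have "est n \<notin> ball th1 r" if n: "n \<ge> N" for n
      proof
        assume b: "est n \<in> ball th1 r"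
        define a where "a th = (\<Sum>t=1..n. egarch_loss (obs w (int t)) (egarch_logh s th (\<lambda>t. obs w (int t)) t))" for th
        define h where "h th = (\<Sum>t=1..n. egarch_loss (obs w (int t)) (egarch_h th (obs w) (int t)))" for th
        have d: "\<bar>a th - h th\<bar> \<le> C'" if "th \<in> K" for th
          unfolding a_def h_def sum_subtractf[symmetric]
          using C' that by (intro order_trans[OF sum_abs]) blast
        have "a (est n) \<le> a th0" using lik[rule_format, of n] unfolding lik_eq a_def by simp
        moreover have "h th0 - h (est n) \<le> C - c * real n"
          using C[rule_format, of "est n" n] K b elim(4) unfolding h_def sum_subtractf[symmetric] by simp
        moreover have "\<bar>a th0 - h th0\<bar> \<le> C'" "\<bar>a (est n) - h (est n)\<bar> \<le> C'" using d th0_K K by auto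
        ultimately have "c * real n \<le> C + 2 * C'" by linarith
        moreover have "C + 2 * C' < c * real N" using N c by (simp add: divide_less_eq mult.commute)
        moreover have "c * real N \<le> c * real n" using n c by (intro mult_left_mono) auto
        ultimately show False by linarith
      qed
      then show "\<forall>\<^sub>F n in sequentially. est n \<notin> ball th1 r" by (intro eventually_sequentiallyI[of N]) blast
    qed
  qed
  then show ?thesis using r by blast
qed

text \<open>Outside a ball around \<open>th0\<close> the compact set \<open>K\<close> is covered by
  finitely many of the avoided balls, so finitely many null sets and thresholds suffice; countably
  many radii then give convergence.\<close>

theorem AE_maximizers_tendsto:
  "AE w in W. \<forall>est. (\<forall>n. est n \<in> K) \<longrightarrow>
      (\<forall>n. egarch_lik s th0 (\<lambda>t. obs w (int t)) n \<le> egarch_lik s (est n) (\<lambda>t. obs w (int t)) n) \<longrightarrow>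
      est \<longlonglongrightarrow> th0"
proof -
  define ok where "ok w est \<longleftrightarrow> (\<forall>n. est n \<in> K) \<and>
      (\<forall>n. egarch_lik s th0 (\<lambda>t. obs w (int t)) n \<le> egarch_lik s (est n) (\<lambda>t. obs w (int t)) n)" for w est
  have "\<forall>th\<in>K - {th0}. \<exists>r>0. AE w in W. \<forall>est. ok w est \<longrightarrow> (\<forall>\<^sub>F n in sequentially. est n \<notin> ball th r)"
    unfolding ok_def imp_conjL by (intro ballI AE_maximizer_avoids) auto
  then obtain r where r: "\<And>th. th \<in> K - {th0} \<Longrightarrow> r th > 0"
      "\<And>th. th \<in> K - {th0} \<Longrightarrow> AE w in W. \<forall>est. ok w est \<longrightarrow> (\<forall>\<^sub>F n in sequentially. est n \<notin> ball th (r th))"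
    unfolding bchoice_iff by blast
  have near: "AE w in W. \<forall>est. ok w est \<longrightarrow> (\<forall>\<^sub>F n in sequentially. dist (est n) th0 < e)" if e: "e > 0" for e
  proof -
    have "compact (K - ball th0 e)" using K_compact by (rule compact_diff) simp
    moreover have "K - ball th0 e \<subseteq> (\<Union>th\<in>K - {th0}. ball th (r th))" using r(1) e by fastforce
    ultimately obtain F where F: "F \<subseteq> K - {th0}" "finite F" "K - ball th0 e \<subseteq> (\<Union>th\<in>F. ball th (r th))"
      by (elim compactE_image) auto
    have "AE w in W. \<forall>th\<in>F. \<forall>est. ok w est \<longrightarrow> (\<forall>\<^sub>F n in sequentially. est n \<notin> ball th (r th))"
    proof (rule AE_finite_allI[OF F(2)])
      fix th assume "th \<in> F"
      then have "th \<in> K - {th0}" using F(1) by (rule rev_subsetD)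
      then show "AE w in W. \<forall>est. ok w est \<longrightarrow> (\<forall>\<^sub>F n in sequentially. est n \<notin> ball th (r th))" by (rule r(2))
    qed
    then show ?thesis
    proof (rule AE_mp, intro AE_I2 impI allI)
      fix w est assume a: "\<forall>th\<in>F. \<forall>est. ok w est \<longrightarrow> (\<forall>\<^sub>F n in sequentially. est n \<notin> ball th (r th))" and est: "ok w est"
      have "\<forall>\<^sub>F n in sequentially. \<forall>th\<in>F. est n \<notin> ball th (r th)"
        using a est F(2) by (intro eventually_ball_finite) auto
      then show "\<forall>\<^sub>F n in sequentially. dist (est n) th0 < e"
      proof (rule eventually_mono)
        fix n assume "\<forall>th\<in>F. est n \<notin> ball th (r th)"
        then have "est n \<notin> K - ball th0 e" using F(3) by blast
        then show "dist (est n) th0 < e" using est by (simp add: ok_def dist_commute)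
      qed
    qed
  qed
  have "AE w in W. \<forall>m. \<forall>est. ok w est \<longrightarrow> (\<forall>\<^sub>F n in sequentially. dist (est n) th0 < inverse (real (Suc m)))"
    unfolding AE_all_countable using near by simp
  then show ?thesis
  proof (rule AE_mp, intro AE_I2 impI allI)
    fix w est
    assume a: "\<forall>m. \<forall>est. ok w est \<longrightarrow> (\<forall>\<^sub>F n in sequentially. dist (est n) th0 < inverse (real (Suc m)))"
      and "\<forall>n. est n \<in> K"
      and "\<forall>n. egarch_lik s th0 (\<lambda>t. obs w (int t)) n \<le> egarch_lik s (est n) (\<lambda>t. obs w (int t)) n"
    then have ok: "ok w est" by (simp add: ok_def)
    show "est \<longlonglongrightarrow> th0"
    proof (rule tendstoI)
      fix e :: real assume "0 < e"
      then obtain m where m: "inverse (real (Suc m)) < e" using reals_Archimedean by blast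
      have "\<forall>\<^sub>F n in sequentially. dist (est n) th0 < inverse (real (Suc m))" using a ok by blast
      then show "\<forall>\<^sub>F n in sequentially. dist (est n) th0 < e"
        by (rule eventually_mono) (use m in linarith)
    qed
  qed
qed

end

section \<open>Transfer from the path space to the given probability space\<close>

theorem theorem5p1:
  fixes M :: "'a measure"
    and Z X sig :: "int \<Rightarrow> 'a \<Rightarrow> real"
    and \<alpha>0 \<beta>0 \<gamma>0 \<delta>0 :: real
    and K :: "egarch_param set"
    and s :: real
    and thetahat :: "nat \<Rightarrow> 'a \<Rightarrow> egarch_param"
  assumes ps: "prob_space M"
    and Zmeas: "\<And>t. Z t \<in> borel_measurable M"
    and Zindep: "prob_space.indep_vars M (\<lambda>_. borel) Z UNIV"
    and Zident: "\<And>t. distr M borel (Z t) = distr M borel (Z 0)"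
    and Zint: "integrable M (Z 0)" and Zmean: "prob_space.expectation M (Z 0) = 0"
    and Zint2: "integrable M (\<lambda>w. (Z 0 w)\<^sup>2)"
    and Zvar: "prob_space.expectation M (\<lambda>w. (Z 0 w)\<^sup>2) = 1"
    and Znot2: "\<And>a b. measure M {w \<in> space M. Z 0 w = a \<or> Z 0 w = b} < 1"
    and b0: "0 \<le> \<beta>0" "\<beta>0 < 1"
    and d0: "\<delta>0 \<ge> \<bar>\<gamma>0\<bar>"
    and gd0: "(\<gamma>0, \<delta>0) \<noteq> (0, 0)"
    and sigpos: "\<And>t w. w \<in> space M \<Longrightarrow> sig t w > 0"
    and Xdef: "\<And>t w. X t w = sig t w * Z t w"
    and recur: "AE w in M. \<forall>t. ln ((sig t w)\<^sup>2)
                 = \<alpha>0 + \<beta>0 * ln ((sig (t - 1) w)\<^sup>2) + \<gamma>0 * Z (t - 1) w + \<delta>0 * \<bar>Z (t - 1) w\<bar>"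
    and stat: "AE w in M. \<forall>t. ln ((sig t w)\<^sup>2)
                 = \<alpha>0 / (1 - \<beta>0)
                   + (\<Sum>k. \<beta>0 ^ k * (\<gamma>0 * Z (t - 1 - int k) w + \<delta>0 * \<bar>Z (t - 1 - int k) w\<bar>))"
    and Kcomp: "compact K"
    and Ksub: "K \<subseteq> egarch_space"
    and th0K: "(\<alpha>0, \<beta>0, \<gamma>0, \<delta>0) \<in> K"
    and Klog: "log_mean_neg M (\<lambda>w. supK K (\<lambda>th. egarch_lambda0 K th (X 0 w)))"
    and spos: "s > 0"
    and thK: "\<And>n w. w \<in> space M \<Longrightarrow> thetahat n w \<in> K"
    and thmax: "\<And>n w th. w \<in> space M \<Longrightarrow> th \<in> K \<Longrightarrow>
                  egarch_lik s th (\<lambda>t. X (int t) w) n \<le> egarch_lik s (thetahat n w) (\<lambda>t. X (int t) w) n"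
  shows "AE w in M. (\<lambda>n. thetahat n w) \<longlonglongrightarrow> (\<alpha>0, \<beta>0, \<gamma>0, \<delta>0)"
proof -
  interpret M: prob_space M by (rule ps)
  let ?th0 = "(\<alpha>0, \<beta>0, \<gamma>0, \<delta>0)"
  define D where "D = distr M borel (Z 0)"
  define path where "path w = (\<lambda>t. Z t w)" for w
  note [measurable] = Zmeas
  have th0: "par_alpha ?th0 = \<alpha>0" "par_beta ?th0 = \<beta>0" "par_gamma ?th0 = \<gamma>0" "par_delta ?th0 = \<delta>0"
    by (simp_all add: par_alpha_def par_beta_def par_gamma_def par_delta_def)
  interpret egarch_model D ?th0
  proof (intro egarch_model.intro iid_path.intro egarch_model_axioms.intro)
    show "prob_space D" unfolding D_def by (rule M.prob_space_distr) simp
    show "sets D = sets borel" by (simp add: D_def)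
    show "integrable D (\<lambda>z. z)" "integrable D (\<lambda>z. z\<^sup>2)"
      using Zint Zint2 by (simp_all add: D_def integrable_distr_eq)
    show "(\<integral>z. z \<partial>D) = 0" "(\<integral>z. z\<^sup>2 \<partial>D) = 1"
      using Zmean Zvar by (simp_all add: D_def integral_distr)
    show "measure D {a, b} < 1" for a b
    proof -
      have "measure D {a, b} = measure M (Z 0 -` {a, b} \<inter> space M)"
        unfolding D_def by (rule measure_distr) auto
      also have "Z 0 -` {a, b} \<inter> space M = {w \<in> space M. Z 0 w = a \<or> Z 0 w = b}" by auto
      finally show ?thesis using Znot2 by simp
    qed
    show "?th0 \<in> egarch_space" using th0K Ksub by blast
    show "(par_gamma ?th0, par_delta ?th0) \<noteq> (0, 0)" unfolding th0 by (rule gd0)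
  qed
  interpret K: egarch_compact K
    using Kcomp Ksub th0K by unfold_locales auto
  have path [measurable]: "path \<in> measurable M W"
    by (rule measurable_W_I) (simp add: path_def D_def)
  \<comment> \<open>Independence is used in the form that the joint law of all innovations is the
    product of their laws, which makes \<open>path\<close> carry \<open>M\<close> to
    \<open>W\<close>.\<close>
  have "distr M (PiM UNIV (\<lambda>_. borel)) (\<lambda>w. \<lambda>i\<in>UNIV. Z i w) = PiM UNIV (\<lambda>i. distr M borel (Z i))"
    using Zindep by (subst (asm) M.indep_vars_iff_distr_eq_PiM) auto
  moreover have "(\<lambda>i. distr M borel (Z i)) = (\<lambda>_. D)" unfolding D_def by (intro ext Zident)
  moreover have "distr M W path = distr M (PiM UNIV (\<lambda>_. borel)) (\<lambda>w. \<lambda>i\<in>UNIV. Z i w)"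
  proof (rule distr_cong[OF refl])
    show "sets W = sets (PiM UNIV (\<lambda>_. borel))"
      unfolding W_def by (rule sets_PiM_cong) (simp_all add: sets_D)
  qed (simp add: path_def restrict_def)
  ultimately have distr_path: "distr M W path = W" by (simp add: W_def)
  have AE_path: "AE w in M. P (path w)" if "AE w in W. P w" for P
    using AE_distrD[OF path, of P] that unfolding distr_path by blast
  \<comment> \<open>The series for the log-volatility, with \<open>sig\<close> positive, recovers
    \<open>sig\<close> and makes the observations a function of the innovation path.\<close>
  have X_eq: "AE w in M. \<forall>t. X t w = obs (path w) t"
    using stat AE_space
  proof eventually_elim
    case (elim w)
    show ?case
    proof
      fix t
      have "ln ((sig t w)\<^sup>2) = logvol (path w) t"
        using elim(1) by (simp add: logvol_def egarch_lo_def news_def path_def th0)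
      then have "logvol (path w) t / 2 = ln (sig t w)" using sigpos[OF elim(2), of t] by (simp add: ln_realpow)
      then have "exp (logvol (path w) t / 2) = sig t w" using sigpos[OF elim(2), of t] by simp
      then show "X t w = obs (path w) t" by (simp add: obs_def Xdef path_def)
    qed
  qed
  interpret egarch_qmle D ?th0 K
  proof (intro egarch_qmle.intro egarch_qmle_axioms.intro)
    show "egarch_model D ?th0" "egarch_compact K" by unfold_locales
    show "?th0 \<in> K" by (rule th0K)
    \<comment> \<open>Measurability of \<open>Lam\<close> is already needed to verify the
      assumptions of \<open>egarch_qmle\<close>, before its facts are available.\<close>
    have m: "K.Lam \<in> borel_measurable borel"
      using K.continuous_Lam by (rule borel_measurable_continuous_onI)
    have cong: "AE w in M. supK K (\<lambda>th. egarch_lambda0 K th (X 0 w)) = K.Lam (obs (path w) 0)"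
      using X_eq by eventually_elim (simp add: K.Lam_def)
    \<comment> \<open>The condition compares two extended integrals of nonnegative functions of the
      same variable, so one change of variables serves both.\<close>
    have transfer: "(\<integral>\<^sup>+w. \<phi> (supK K (\<lambda>th. egarch_lambda0 K th (X 0 w))) \<partial>M) = (\<integral>\<^sup>+w. \<phi> (K.Lam (obs w 0)) \<partial>W)"
      if [measurable]: "\<phi> \<in> borel_measurable borel" for \<phi> :: "real \<Rightarrow> ennreal"
    proof -
      note [measurable] = m
      have "(\<integral>\<^sup>+w. \<phi> (supK K (\<lambda>th. egarch_lambda0 K th (X 0 w))) \<partial>M) = (\<integral>\<^sup>+w. \<phi> (K.Lam (obs (path w) 0)) \<partial>M)"
        by (rule nn_integral_cong_AE) (use cong in eventually_elim, simp)
      also have "\<dots> = (\<integral>\<^sup>+w. \<phi> (K.Lam (obs w 0)) \<partial>distr M W path)"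
        by (rule nn_integral_distr[symmetric]) measurable
      finally show ?thesis unfolding distr_path .
    qed
    show "log_mean_neg W (\<lambda>w. K.Lam (obs w 0))"
      using Klog unfolding log_mean_neg_def
      using transfer[of "\<lambda>v. ennreal (max 0 (ln v))"]
        transfer[of "\<lambda>v. if v \<le> 0 then \<infinity> else ennreal (max 0 (- ln v))"] by simp
  qed
  show ?thesis
    using AE_path[OF AE_maximizers_tendsto[of s]] X_eq AE_space
  proof eventually_elim
    case (elim w)
    have "(\<lambda>t. X (int t) w) = (\<lambda>t. obs (path w) (int t))" using elim(2) by simp
    then have "egarch_lik s ?th0 (\<lambda>t. obs (path w) (int t)) n
        \<le> egarch_lik s (thetahat n w) (\<lambda>t. obs (path w) (int t)) n" for n
      using thmax[OF elim(3) th0K, of n] by simp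
    with thK[OF elim(3)] show ?case
      by (intro elim(1)[rule_format, of "\<lambda>n. thetahat n w"])
  qed
qed

end
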